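(* Let $d\ge2$ and $n\ge1$. Embed $S_n$ in $S_{dn}$ as $\mathrm{Diag}(S_n^{\times d})$. Let $\mathcal Z_{d;\mathrm{noncolor}}(n)$ be the number of equivalence classes of permutations $\sigma\in S_{dn}$ under $\sigma\sim\gamma_1\sigma\gamma_2$ with $\gamma_1,\gamma_2\in S_n\subset S_{dn}$, i.e. the cardinality of $S_n\backslash S_{dn}/S_n$. Then $$\mathcal Z_{d;\mathrm{noncolor}}(n)=\sum_{p\vdash n}\ \prod_{i=1}^n\frac{i^{(d-2)p_i}\,(d\,p_i)!}{(p_i!)^2}.$$ For all sufficiently large $N$ this number equals the dimension of the space of invariants of $U(N)$ acting diagonally on $\mathrm{Sym}^n(V^{\otimes d})\otimes\mathrm{Sym}^n(\bar V^{\otimes d})$, where $V=\mathbb C^N$ is the fundamental representation of $U(N)$.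
   Context: A partition $p\vdash n$ is written $p=(p_1,\dots,p_n)$ with $p_i$ the number of parts equal to $i$, $\sum_iip_i=n$. Regard $S_{dn}$ as the permutation group of the $dn$ pairs $(a,\alpha)$, $a\in\{1,\dots,n\}$, $\alpha\in\{1,\dots,d\}$; the embedding $S_n=\mathrm{Diag}(S_n^{\times d})\subset S_{dn}$ sends $\gamma$ to the permutation $(a,\alpha)\mapsto(\gamma(a),\alpha)$. $\mathrm{Sym}^n(U)$ denotes the symmetric part of $U^{\otimes n}$, and $\bar V$ is the complex conjugate of $V$. *)

theory Defs
  imports
    "HOL-Combinatorics.Permutations"
    "HOL-Library.Function_Algebras"
    "Jordan_Normal_Form.Schur_Decomposition"
begin

section \<open>Double cosets of \<open>S\<^sub>n\<close> in \<open>S\<^sub>d\<^sub>n\<close>\<close>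

definition pairs :: "nat \<Rightarrow> nat \<Rightarrow> (nat \<times> nat) set" where
  "pairs d n = {1..n} \<times> {1..d}"

definition Sym_pairs :: "nat \<Rightarrow> nat \<Rightarrow> (nat \<times> nat \<Rightarrow> nat \<times> nat) set" where
  "Sym_pairs d n = {\<sigma>. \<sigma> permutes pairs d n}"

text \<open>As \<open>permutes\<close> requires, the image of \<open>\<gamma>\<close> is the identity outside \<open>pairs d n\<close>.\<close>

definition diag_embed :: "nat \<Rightarrow> (nat \<Rightarrow> nat) \<Rightarrow> nat \<times> nat \<Rightarrow> nat \<times> nat" where
  "diag_embed d \<gamma> = (\<lambda>(a, \<alpha>). if \<alpha> \<in> {1..d} then (\<gamma> a, \<alpha>) else (a, \<alpha>))"

definition Sym_diag :: "nat \<Rightarrow> nat \<Rightarrow> (nat \<times> nat \<Rightarrow> nat \<times> nat) set" where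
  "Sym_diag d n = diag_embed d ` {\<gamma>. \<gamma> permutes {1..n}}"

definition noncolor_rel ::
  "nat \<Rightarrow> nat \<Rightarrow> ((nat \<times> nat \<Rightarrow> nat \<times> nat) \<times> (nat \<times> nat \<Rightarrow> nat \<times> nat)) set" where
  "noncolor_rel d n = {(\<sigma>, \<tau>). \<sigma> \<in> Sym_pairs d n \<and> \<tau> \<in> Sym_pairs d n \<and>
     (\<exists>\<gamma>\<^sub>1 \<in> Sym_diag d n. \<exists>\<gamma>\<^sub>2 \<in> Sym_diag d n. \<tau> = \<gamma>\<^sub>1 \<circ> \<sigma> \<circ> \<gamma>\<^sub>2)}"

definition Z_noncolor :: "nat \<Rightarrow> nat \<Rightarrow> nat" where
  "Z_noncolor d n = card (Sym_pairs d n // noncolor_rel d n)"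

text \<open>Partitions of \<open>n\<close> in multiplicity form: \<open>p i\<close> is the number of parts equal to \<open>i\<close>.\<close>

definition partitions_of :: "nat \<Rightarrow> (nat \<Rightarrow> nat) set" where
  "partitions_of n = {p. (\<forall>i. i \<notin> {1..n} \<longrightarrow> p i = 0) \<and> (\<Sum>i=1..n. i * p i) = n}"

section \<open>Tensor spaces in coordinates\<close>

text \<open>
  A space with a basis indexed by a finite set \<open>I\<close> is modelled as the space \<open>coord_space I\<close>
  of coordinate functions vanishing outside \<open>I\<close>. A linear operator on it is given by its matrix
  \<open>K :: 'i \<Rightarrow> 'i \<Rightarrow> complex\<close>, of which only the entries in \<open>I \<times> I\<close> matter. The tensor product of
  two such spaces has basis \<open>I \<times> J\<close>, and the \<open>m\<close>-th tensor power has as basis the lists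
  of length \<open>m\<close> over \<open>I\<close>; the matrix of a tensor product of operators is the product
  of the matrix entries.
\<close>

interpretation fun_space: vector_space "\<lambda>(c::complex) (v::'i \<Rightarrow> complex) x. c * v x"
  by unfold_locales (auto simp: fun_eq_iff algebra_simps)

definition coord_space :: "'i set \<Rightarrow> ('i \<Rightarrow> complex) set" where
  "coord_space I = {v. \<forall>x. x \<notin> I \<longrightarrow> v x = 0}"

definition apply_op :: "'i set \<Rightarrow> ('i \<Rightarrow> 'i \<Rightarrow> complex) \<Rightarrow> ('i \<Rightarrow> complex) \<Rightarrow> ('i \<Rightarrow> complex)" where
  "apply_op I K v = (\<lambda>x. if x \<in> I then (\<Sum>y\<in>I. K x y * v y) else 0)"

definition tuples :: "nat \<Rightarrow> 'i set \<Rightarrow> 'i list set" where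
  "tuples m I = {xs. length xs = m \<and> set xs \<subseteq> I}"

definition op_power :: "nat \<Rightarrow> ('i \<Rightarrow> 'i \<Rightarrow> complex) \<Rightarrow> 'i list \<Rightarrow> 'i list \<Rightarrow> complex" where
  "op_power m K = (\<lambda>xs ys. \<Prod>k<m. K (xs ! k) (ys ! k))"

definition op_tensor :: "('i \<Rightarrow> 'i \<Rightarrow> complex) \<Rightarrow> ('j \<Rightarrow> 'j \<Rightarrow> complex)
    \<Rightarrow> 'i \<times> 'j \<Rightarrow> 'i \<times> 'j \<Rightarrow> complex" where
  "op_tensor K L = (\<lambda>(x, y) (x', y'). K x x' * L y y')"

text \<open>The tensor product of two subspaces, inside the tensor product of the ambient spaces.\<close>

definition tensor_subspace ::
  "('i \<Rightarrow> complex) set \<Rightarrow> ('j \<Rightarrow> complex) set \<Rightarrow> ('i \<times> 'j \<Rightarrow> complex) set" where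
  "tensor_subspace A B = fun_space.span {\<lambda>(x, y). s x * t y | s t. s \<in> A \<and> t \<in> B}"

text \<open>\<open>Sym\<^sup>n(U)\<close> for \<open>U = coord_space I\<close>.\<close>

definition Sym_power :: "nat \<Rightarrow> 'i set \<Rightarrow> ('i list \<Rightarrow> complex) set" where
  "Sym_power n I = {T \<in> coord_space (tuples n I).
     \<forall>\<pi>. \<pi> permutes {..<n} \<longrightarrow> (\<forall>xs \<in> tuples n I. T (permute_list \<pi> xs) = T xs)}"

section \<open>Unitary invariants\<close>

definition unitary_group :: "nat \<Rightarrow> complex mat set" where
  "unitary_group N = {g \<in> carrier_mat N N. mat_adjoint g * g = 1\<^sub>m N}"

definition fund_op :: "complex mat \<Rightarrow> nat \<Rightarrow> nat \<Rightarrow> complex" where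
  "fund_op g = (\<lambda>i j. g $$ (i, j))"

text \<open>On the conjugate space, in the basis conjugate to the standard one, \<open>g\<close> acts by its
  entrywise conjugate.\<close>

definition conj_op :: "complex mat \<Rightarrow> nat \<Rightarrow> nat \<Rightarrow> complex" where
  "conj_op g = (\<lambda>i j. cnj (g $$ (i, j)))"

text \<open>Basis of \<open>(V\<^sup>\<otimes>\<^sup>d)\<^sup>\<otimes>\<^sup>n\<close>, and likewise of its conjugate, where \<open>V\<close> has basis \<open>{..<N}\<close>.\<close>

definition tensor_basis :: "nat \<Rightarrow> nat \<Rightarrow> nat \<Rightarrow> nat list list set" where
  "tensor_basis d n N = tuples n (tuples d {..<N})"

definition diag_action :: "nat \<Rightarrow> nat \<Rightarrow> nat \<Rightarrow> complex mat
    \<Rightarrow> (nat list list \<times> nat list list \<Rightarrow> complex) \<Rightarrow> (nat list list \<times> nat list list \<Rightarrow> complex)" where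
  "diag_action d n N g =
     apply_op (tensor_basis d n N \<times> tensor_basis d n N)
       (op_tensor (op_power n (op_power d (fund_op g))) (op_power n (op_power d (conj_op g))))"

definition SymSym :: "nat \<Rightarrow> nat \<Rightarrow> nat \<Rightarrow> (nat list list \<times> nat list list \<Rightarrow> complex) set" where
  "SymSym d n N =
     tensor_subspace (Sym_power n (tuples d {..<N})) (Sym_power n (tuples d {..<N}))"

definition invariants :: "nat \<Rightarrow> nat \<Rightarrow> nat \<Rightarrow> (nat list list \<times> nat list list \<Rightarrow> complex) set" where
  "invariants d n N = {T \<in> SymSym d n N. \<forall>g \<in> unitary_group N. diag_action d n N g T = T}"

end

theory Submission
  imports Defs "HOL-Combinatorics.Cycles"
begin

text \<open>
  By Burnside, \<open>n!\<^sup>2\<close> times the number of double cosets counts the triples \<open>(\<gamma>, \<delta>, \<sigma>)\<close> with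
  \<open>\<gamma> \<sigma> = \<sigma> \<delta>\<close>. Such a \<open>\<sigma>\<close> exists only if \<open>\<gamma>\<close> and \<open>\<delta>\<close> have the same cycle type \<open>p\<close>, and then the
  number of them is the order \<open>z\<^sub>d\<^sub>p\<close> of a centralizer in the big group, where
  \<open>z\<^sub>p = \<Prod>\<^sub>i i\<^sup>p\<^sup>i p\<^sub>i!\<close>. As \<open>n! / z\<^sub>p\<close> permutations have type \<open>p\<close>, the count is
  \<open>\<Sum>\<^sub>p z\<^sub>d\<^sub>p / z\<^sub>p\<^sup>2\<close>.

  For \<open>N \<ge> m = d n\<close> the invariants of \<open>V\<^sup>\<otimes>\<^sup>m \<otimes> \<bar>V\<^sup>\<otimes>\<^sup>m\<close> are spanned by the linearly independent
  permutation tensors: fix a multi-index \<open>w\<close> with distinct entries; by torus invariance the row of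
  \<open>w\<close> in an invariant tensor agrees with the one of a combination of permutation tensors, and an
  invariant whose row at \<open>w\<close> vanishes is zero, because one can move from \<open>w\<close> to any other row by
  permutation matrices and reflections in coordinate planes. Symmetry under \<open>S\<^sub>n \<times> S\<^sub>n\<close> means
  that the coefficients are constant on double cosets.
\<close>


text \<open>One count of intertwiners serves twice: for the lifted permutations of the pairs it
  gives the fixed points in the orbit count, and on a single set it gives centralizers, hence the
  sizes of conjugacy classes. Lifting to the pairs multiplies the number of cycles of each length by
  d, which is why p turns into d p, and the quotient of z_(dp) by z_p squared has the factor
  i^((d-2) p_i) (d p_i)! / (p_i!)^2 at i.

  On the tensor side the difficulty is spanning. Only two kinds of unitary matrices are tested.
  Monomial matrices detect how often each value occurs in an index, but they preserve the pattern of
  coincidences among its entries. A reflection whose plane block has no zero entry is what links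
  indices with different patterns. Evaluation at w and its rearrangements both reads off the
  coefficients of an invariant and shows that the tensors of distinct double cosets are
  independent.\<close>

unbundle no m_inv_syntax

section \<open>Counting intertwiners of two permutations\<close>

lemma funpow_bij_betw: "bij_betw f A A \<Longrightarrow> bij_betw (f ^^ k) A A"
proof (induction k)
  case (Suc k)
  then show ?case using bij_betw_trans[of "f ^^ k" A A f A] by (simp add: o_def)
qed (auto simp: bij_betw_def)

lemma funpow_in_bij: "bij_betw f A A \<Longrightarrow> a \<in> A \<Longrightarrow> (f ^^ k) a \<in> A"
  using funpow_bij_betw bij_betwE by blast

text \<open>Here \<open>f\<close> is arbitrary outside \<open>A\<close>. Replacing it there by the
  identity gives a genuine permutation with the same powers at \<open>a\<close>, for which the
  return to \<open>a\<close> is known.\<close>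

lemma bij_betw_least_power:
  assumes "finite A" "bij_betw f A A" "a \<in> A"
  shows "(f ^^ least_power f a) a = a \<and> 0 < least_power f a"
proof -
  define g where "g = (\<lambda>x. if x \<in> A then f x else x)"
  have "g permutes A"
    by (rule bij_imp_permutes) (use assms in \<open>auto simp: g_def cong: bij_betw_cong\<close>)
  then have "permutation g" using assms(1) permutes_imp_permutation by blast
  then have 1: "(g ^^ least_power g a) a = a" "0 < least_power g a"
    using least_power_of_permutation by metis+
  have 2: "(g ^^ k) a = (f ^^ k) a" for k
    by (induction k) (use funpow_in_bij[OF assms(2,3)] in \<open>auto simp: g_def\<close>)
  show ?thesis
    unfolding least_power_def
    by (rule LeastI[of "\<lambda>n. (f ^^ n) a = a \<and> 0 < n" "least_power g a"]) (use 1 2 in auto)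
qed

lemma funpow_eq_self_iff:
  assumes "finite A" "bij_betw f A A" "a \<in> A"
  shows "(f ^^ k) a = a \<longleftrightarrow> least_power f a dvd k"
proof -
  define p where "p = least_power f a"
  have p: "(f ^^ p) a = a" "0 < p" using bij_betw_least_power[OF assms] by (auto simp: p_def)
  have mult: "(f ^^ (p * q)) a = a" for q
    by (induction q) (auto simp: funpow_add p)
  show ?thesis
  proof
    assume k: "(f ^^ k) a = a"
    have "(f ^^ (k mod p)) a = (f ^^ (k mod p + p * (k div p))) a"
      unfolding funpow_add by (simp add: mult)
    then have "(f ^^ (k mod p)) a = a" using k by simp
    moreover have "\<not> 0 < k mod p"
    proof
      assume "0 < k mod p"
      then have "p \<le> k mod p"
        unfolding p_def least_power_def[of f a]
        using \<open>(f ^^ (k mod p)) a = a\<close>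
        by (intro Least_le) (auto simp: p_def least_power_def)
      then show False using p(2) mod_less_divisor[of p k] by linarith
    qed
    ultimately show "least_power f a dvd k" by (auto simp: p_def)
  next
    assume "least_power f a dvd k"
    then show "(f ^^ k) a = a" using mult by (auto simp: p_def)
  qed
qed

text \<open>Cancelling the smaller power by injectivity reduces the equality to a return of
  \<open>a\<close> to itself.\<close>

lemma funpow_eq_iff_mod:
  assumes "finite A" "bij_betw f A A" "a \<in> A"
  shows "(f ^^ i) a = (f ^^ j) a \<longleftrightarrow> i mod least_power f a = j mod least_power f a"
proof -
  have *: "(f ^^ i) a = (f ^^ j) a \<longleftrightarrow> i mod least_power f a = j mod least_power f a"
    if "i \<le> j" for i j
  proof -
    have "(f ^^ j) a = (f ^^ i) ((f ^^ (j - i)) a)"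
      using that fun_cong[OF funpow_add[of i "j - i" f], of a] by simp
    moreover have "inj_on (f ^^ i) A"
      using funpow_bij_betw[OF assms(2)] by (auto simp: bij_betw_def)
    ultimately have "(f ^^ i) a = (f ^^ j) a \<longleftrightarrow> (f ^^ (j - i)) a = a"
      using assms(3) funpow_in_bij[OF assms(2,3)] by (auto simp: inj_on_eq_iff)
    also have "\<dots> \<longleftrightarrow> least_power f a dvd (j - i)" by (rule funpow_eq_self_iff[OF assms])
    also have "\<dots> \<longleftrightarrow> i mod least_power f a = j mod least_power f a"
      using that mod_eq_dvd_iff_nat[of i j] by metis
    finally show ?thesis .
  qed
  show ?thesis using *[of i j] *[of j i] by (cases "i \<le> j") auto
qed

text \<open>Forward powers suffice: for a bijection of a finite set they already run through the
  whole cycle.\<close>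

definition cyc :: "('a \<Rightarrow> 'a) \<Rightarrow> 'a \<Rightarrow> 'a set" where
  "cyc f a = range (\<lambda>k. (f ^^ k) a)"

lemma cyc_bounded:
  assumes "finite A" "bij_betw f A A" "a \<in> A"
  shows "bij_betw (\<lambda>k. (f ^^ k) a) {..<least_power f a} (cyc f a)"
proof -
  have p: "0 < least_power f a" using bij_betw_least_power[OF assms] by auto
  have "(f ^^ k) a \<in> (\<lambda>k. (f ^^ k) a) ` {..<least_power f a}" for k
    by (rule image_eqI[of _ _ "k mod least_power f a"])
      (use p funpow_eq_iff_mod[OF assms, of k "k mod least_power f a"] in auto)
  then show ?thesis
    unfolding bij_betw_def cyc_def
    by (auto intro!: inj_onI simp: funpow_eq_iff_mod[OF assms])
qed

lemma card_cyc:
  assumes "finite A" "bij_betw f A A" "a \<in> A"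
  shows "card (cyc f a) = least_power f a"
  using bij_betw_same_card[OF cyc_bounded[OF assms]] by simp

lemma cyc_subset: "bij_betw f A A \<Longrightarrow> a \<in> A \<Longrightarrow> cyc f a \<subseteq> A"
  using funpow_in_bij by (auto simp: cyc_def)

lemma bij_betw_cyc:
  assumes "finite A" "bij_betw f A A" "a \<in> A"
  shows "bij_betw f (cyc f a) (cyc f a)"
proof -
  have fin: "finite (cyc f a)" using cyc_subset[OF assms(2,3)] assms(1) finite_subset by blast
  have inj: "inj_on f (cyc f a)"
    using assms(2) cyc_subset[OF assms(2,3)] inj_on_subset by (auto simp: bij_betw_def)
  have "f ((f ^^ k) a) \<in> cyc f a" for k
    unfolding cyc_def by (rule range_eqI[of _ _ "Suc k"]) simp
  then have "f ` cyc f a \<subseteq> cyc f a" by (auto simp: cyc_def)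
  then show ?thesis
    using endo_inj_surj[OF fin _ inj] inj by (auto simp: bij_betw_def)
qed

lemma bij_betw_Diff_cyc:
  assumes "finite A" "bij_betw f A A" "a \<in> A"
  shows "bij_betw f (A - cyc f a) (A - cyc f a)"
  by (rule bij_betw_DiffI[OF assms(2) bij_betw_cyc[OF assms]
        cyc_subset[OF assms(2,3)] cyc_subset[OF assms(2,3)]])

lemma least_power_in_cyc:
  assumes "finite A" "bij_betw f A A" "a \<in> A" "x \<in> cyc f a"
  shows "least_power f x = least_power f a"
proof -
  obtain k where k: "x = (f ^^ k) a" using assms(4) by (auto simp: cyc_def)
  have "(f ^^ j) x = x \<longleftrightarrow> (f ^^ j) a = a" for j
  proof -
    have "(f ^^ j) x = (f ^^ k) ((f ^^ j) a)"
      unfolding k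
      using fun_cong[OF funpow_add[of j k f], of a] fun_cong[OF funpow_add[of k j f], of a]
      by (simp add: add.commute)
    moreover have "inj_on (f ^^ k) A"
      using funpow_bij_betw[OF assms(2)] by (auto simp: bij_betw_def)
    ultimately show ?thesis
      using assms(3) funpow_in_bij[OF assms(2,3)] by (auto simp: inj_on_eq_iff k)
  qed
  then show ?thesis unfolding least_power_def by simp
qed

text \<open>Points are counted instead of cycles because this number changes additively when a cycle
  is removed and is multiplied by d under the diagonal embedding.\<close>

definition num_period :: "'a set \<Rightarrow> ('a \<Rightarrow> 'a) \<Rightarrow> nat \<Rightarrow> nat" where
  "num_period A f i = card {a \<in> A. least_power f a = i}"

lemma num_period_Diff_cyc:
  assumes "finite A" "bij_betw f A A" "a \<in> A"
  shows "num_period A f i = num_period (A - cyc f a) f i + (if i = least_power f a then i else 0)"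
proof -
  have fin: "finite (cyc f a)" using cyc_subset[OF assms(2,3)] assms(1) finite_subset by blast
  have "{x \<in> A. least_power f x = i} =
     {x \<in> A - cyc f a. least_power f x = i} \<union> (if i = least_power f a then cyc f a else {})"
    using cyc_subset[OF assms(2,3)] least_power_in_cyc[OF assms] by auto
  also have "card \<dots> = num_period (A - cyc f a) f i + card (if i = least_power f a then cyc f a else {})"
    unfolding num_period_def by (rule card_Un_disjoint) (use assms(1) fin in auto)
  finally show ?thesis using card_cyc[OF assms] by (simp add: num_period_def)
qed

lemma finite_remove_cyc_induct [consumes 2, case_names empty remove]:
  assumes "finite A" "bij_betw f A A"
    and "P {}"
    and "\<And>A a. finite A \<Longrightarrow> bij_betw f A A \<Longrightarrow> a \<in> A \<Longrightarrow> P (A - cyc f a) \<Longrightarrow> P A"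
  shows "P A"
  using assms(1,2)
proof (induction A rule: finite_psubset_induct)
  case (psubset A)
  show ?case
  proof (cases "A = {}")
    case True
    then show ?thesis using assms(3) by simp
  next
    case False
    then obtain a where a: "a \<in> A" by auto
    have "a \<in> cyc f a" unfolding cyc_def by (rule range_eqI[of _ _ 0]) simp
    then have "A - cyc f a \<subset> A" using a by auto
    then have "P (A - cyc f a)"
      using psubset.IH bij_betw_Diff_cyc[OF psubset.hyps psubset.prems a] by blast
    then show ?thesis by (rule assms(4)[OF psubset.hyps psubset.prems a])
  qed
qed

lemma dvd_num_period:
  assumes "finite A" "bij_betw f A A"
  shows "i dvd num_period A f i"
  using assms
proof (induction rule: finite_remove_cyc_induct)
  case empty
  show ?case by (simp add: num_period_def)
next
  case (remove A a)
  show ?case using remove.IH unfolding num_period_Diff_cyc[OF remove(1-3), of i] by simp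
qed

text \<open>Two sets are needed because the induction below removes different cycles from source and
  target. Being the identity outside \<open>A\<close> makes the set finite and, for
  \<open>A = B\<close>, a set of permutations in the sense of \<open>permutes\<close>.\<close>

definition intertwiners :: "'a set \<Rightarrow> ('a \<Rightarrow> 'a) \<Rightarrow> 'a set \<Rightarrow> ('a \<Rightarrow> 'a) \<Rightarrow> ('a \<Rightarrow> 'a) set" where
  "intertwiners A f B g = {s. bij_betw s A B \<and> (\<forall>a\<in>A. s (f a) = g (s a)) \<and> (\<forall>x. x \<notin> A \<longrightarrow> s x = x)}"

lemma intertwinersD:
  assumes "s \<in> intertwiners A f B g"
  shows "bij_betw s A B" "a \<in> A \<Longrightarrow> s (f a) = g (s a)" "x \<notin> A \<Longrightarrow> s x = x"
  using assms unfolding intertwiners_def by blast+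

lemma funpow_intertwine:
  assumes "bij_betw f A A" "\<And>a. a \<in> A \<Longrightarrow> s (f a) = g (s a)" "a \<in> A"
  shows "s ((f ^^ k) a) = (g ^^ k) (s a)"
  by (induction k) (simp_all add: assms(2) funpow_in_bij[OF assms(1,3)])

lemma least_power_intertwine:
  assumes "bij_betw f A A" "\<And>a. a \<in> A \<Longrightarrow> s (f a) = g (s a)" "inj_on s A" "a \<in> A"
  shows "least_power g (s a) = least_power f a"
proof -
  have "(g ^^ k) (s a) = s a \<longleftrightarrow> (f ^^ k) a = a" for k
    using funpow_intertwine[of f A s g a k] assms funpow_in_bij[of f A a k]
      inj_on_eq_iff[OF assms(3), of "(f ^^ k) a" a] by simp
  then show ?thesis unfolding least_power_def by simp
qed

lemma num_period_intertwine:
  assumes "bij_betw f A A" "\<And>a. a \<in> A \<Longrightarrow> s (f a) = g (s a)" "bij_betw s A B"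
  shows "num_period A f = num_period B g"
proof
  fix i
  note lp = least_power_intertwine[OF assms(1,2) bij_betw_imp_inj_on[OF assms(3)]]
  have "s ` {a \<in> A. least_power f a = i} = {b \<in> B. least_power g b = i}"
    unfolding bij_betw_imp_surj_on[OF assms(3), symmetric] using lp by auto
  then have "bij_betw s {a \<in> A. least_power f a = i} {b \<in> B. least_power g b = i}"
    using bij_betw_subset[OF assms(3), of "{a \<in> A. least_power f a = i}"] by auto
  then show "num_period A f i = num_period B g i"
    unfolding num_period_def by (rule bij_betw_same_card)
qed

text \<open>Once \<open>a\<close> is sent to \<open>b\<close>, the values on the whole cycle of
  \<open>a\<close> are forced, and equal periods make them consistent. What remains free is an
  arbitrary intertwiner of the complements.\<close>

lemma card_intertwiners_remove_cyc:
  assumes A: "finite A" "bij_betw f A A" "a \<in> A"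
    and B: "finite B" "bij_betw g B B" "b \<in> B"
    and p: "least_power f a = least_power g b"
  shows "card {s \<in> intertwiners A f B g. s a = b} =
         card (intertwiners (A - cyc f a) f (B - cyc g b) g)"
proof -
  let ?O = "cyc f a" and ?Q = "cyc g b"
  \<comment> \<open>The forced map from the cycle of \<open>a\<close> to that of \<open>b\<close>.
    The chosen exponent is immaterial: any two admissible ones agree modulo the common
    period.\<close>
  define h where "h = (\<lambda>x. (g ^^ (SOME k. (f ^^ k) a = x)) b)"
  have h: "h ((f ^^ k) a) = (g ^^ k) b" for k
  proof -
    have "(f ^^ (SOME j. (f ^^ j) a = (f ^^ k) a)) a = (f ^^ k) a" by (rule someI) simp
    then show ?thesis
      unfolding h_def using funpow_eq_iff_mod[OF A] funpow_eq_iff_mod[OF B] p by metis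
  qed
  have O: "?O \<subseteq> A" "?Q \<subseteq> B" using cyc_subset A B by metis+
  have bO: "bij_betw h ?O ?Q"
  proof -
    have "inj_on h ?O"
      by (rule inj_onI) (auto simp: cyc_def h funpow_eq_iff_mod[OF A] funpow_eq_iff_mod[OF B] p)
    moreover have "h ` ?O = ?Q" by (auto simp: cyc_def h image_image)
    ultimately show ?thesis by (simp add: bij_betw_def)
  qed
  have fO: "f x \<in> ?O" if "x \<in> ?O" for x using bij_betw_cyc[OF A] bij_betwE that by blast
  have fA: "f x \<in> A - ?O" if "x \<in> A - ?O" for x using bij_betw_Diff_cyc[OF A] bij_betwE that by blast
  have hf: "h (f x) = g (h x)" if "x \<in> ?O" for x
  proof -
    obtain k where "x = (f ^^ k) a" using \<open>x \<in> ?O\<close> by (auto simp: cyc_def)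
    then show ?thesis using h[of k] h[of "Suc k"] by simp
  qed
  have a: "a \<in> ?O" "h a = b" using h[of 0] by (auto simp: cyc_def intro: range_eqI[of _ _ 0])
  \<comment> \<open>Restriction to the complement of the cycle and extension by \<open>h\<close> are
    the two mutually inverse maps.\<close>
  define R where "R = (\<lambda>s x. if x \<in> A - ?O then s x else (x :: 'a))"
  define E where "E = (\<lambda>t x. if x \<in> ?O then h x else (t x :: 'a))"
  have on_O: "s x = h x" if "s \<in> intertwiners A f B g" "s a = b" "x \<in> ?O" for s x
  proof -
    obtain k where "x = (f ^^ k) a" using \<open>x \<in> ?O\<close> by (auto simp: cyc_def)
    then show ?thesis using funpow_intertwine[where s = s and g = g, OF A(2) intertwinersD(2)[OF that(1)] A(3)] h that(2) by simp
  qed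
  have "bij_betw R {s \<in> intertwiners A f B g. s a = b} (intertwiners (A - ?O) f (B - ?Q) g)"
  proof (rule bij_betw_byWitness[where f' = E])
    show "\<forall>s\<in>{s \<in> intertwiners A f B g. s a = b}. E (R s) = s"
    proof (intro ballI ext)
      fix s x assume s: "s \<in> {s \<in> intertwiners A f B g. s a = b}"
      then show "E (R s) x = s x"
        using on_O[of s x] by (auto simp: E_def R_def intertwiners_def)
    qed
    show "\<forall>t\<in>intertwiners (A - ?O) f (B - ?Q) g. R (E t) = t"
      by (auto simp: fun_eq_iff E_def R_def intertwiners_def)
    show "R ` {s \<in> intertwiners A f B g. s a = b} \<subseteq> intertwiners (A - ?O) f (B - ?Q) g"
    proof (rule image_subsetI)
      fix s assume "s \<in> {s \<in> intertwiners A f B g. s a = b}"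
      then have s: "s \<in> intertwiners A f B g" "s a = b" by auto
      have sb: "bij_betw s A B" using s by (auto simp: intertwiners_def)
      have "bij_betw s ?O ?Q" using bO on_O[OF s] by (simp cong: bij_betw_cong)
      then have "bij_betw s (A - ?O) (B - ?Q)" by (rule bij_betw_DiffI[OF sb _ O])
      then have "bij_betw (R s) (A - ?O) (B - ?Q)"
        by (subst bij_betw_cong[where g = s]) (auto simp: R_def)
      moreover have "R s (f x) = g (R s x)" if "x \<in> A - ?O" for x
        using that fA[OF that] intertwinersD(2)[OF s(1), of x] by (simp add: R_def)
      ultimately show "R s \<in> intertwiners (A - ?O) f (B - ?Q) g"
        unfolding intertwiners_def by (simp add: R_def)
    qed
    show "E ` intertwiners (A - ?O) f (B - ?Q) g \<subseteq> {s \<in> intertwiners A f B g. s a = b}"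
    proof (rule image_subsetI)
      fix t assume t: "t \<in> intertwiners (A - ?O) f (B - ?Q) g"
      have "bij_betw (E t) ?O ?Q"
        using bO by (subst bij_betw_cong[where g = h]) (auto simp: E_def)
      moreover have "bij_betw (E t) (A - ?O) (B - ?Q)"
        using intertwinersD(1)[OF t] by (subst bij_betw_cong[where g = t]) (auto simp: E_def)
      ultimately have "bij_betw (E t) (?O \<union> (A - ?O)) (?Q \<union> (B - ?Q))"
        by (rule bij_betw_combine) auto
      moreover have "?O \<union> (A - ?O) = A" "?Q \<union> (B - ?Q) = B" using O by auto
      ultimately have "bij_betw (E t) A B" by simp
      moreover have "E t (f x) = g (E t x)" if "x \<in> A" for x
        using that intertwinersD(2)[OF t, of x] fO[of x] fA[of x] hf[of x]
        by (cases "x \<in> ?O") (simp_all add: E_def)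
      moreover have "E t x = x" if "x \<notin> A" for x
        using that O intertwinersD(3)[OF t, of x] by (auto simp: E_def)
      moreover have "E t a = b" using a by (simp add: E_def)
      ultimately show "E t \<in> {s \<in> intertwiners A f B g. s a = b}"
        unfolding intertwiners_def by simp
    qed
  qed
  then show ?thesis by (rule bij_betw_same_card)
qed

lemma finite_intertwiners: "finite A \<Longrightarrow> finite B \<Longrightarrow> finite (intertwiners A f B g)"
proof -
  assume fin: "finite A" "finite B"
  have "intertwiners A f B g \<subseteq> {s. \<forall>x. (x \<in> A \<longrightarrow> s x \<in> B) \<and> (x \<notin> A \<longrightarrow> s x = x)}"
    by (auto simp: intertwiners_def bij_betw_def)
  moreover have "inj_on (\<lambda>s. restrict s A) {s. \<forall>x. (x \<in> A \<longrightarrow> s x \<in> B) \<and> (x \<notin> A \<longrightarrow> s x = x)}"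
    by (rule inj_onI) (force simp: fun_eq_iff restrict_def split: if_splits)
  moreover have "(\<lambda>s. restrict s A) ` {s. \<forall>x. (x \<in> A \<longrightarrow> s x \<in> B) \<and> (x \<notin> A \<longrightarrow> s x = x)} \<subseteq> A \<rightarrow>\<^sub>E B"
    by auto
  then have "finite ((\<lambda>s. restrict s A) ` {s. \<forall>x. (x \<in> A \<longrightarrow> s x \<in> B) \<and> (x \<notin> A \<longrightarrow> s x = x)})"
    by (rule finite_subset) (use fin in \<open>auto intro: finite_PiE\<close>)
  ultimately show ?thesis by (meson finite_imageD finite_subset)
qed

text \<open>Here \<open>e i\<close> is the number of points of period \<open>i\<close>, so that there are \<open>e i div i\<close> cycles of
  length \<open>i\<close>.\<close>

definition centralizer_size :: "nat \<Rightarrow> (nat \<Rightarrow> nat) \<Rightarrow> nat" where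
  "centralizer_size M e = (\<Prod>i=1..M. i ^ (e i div i) * fact (e i div i))"

text \<open>The image of \<open>a\<close> can be any point of \<open>B\<close> with the period i of
  \<open>a\<close>. If c cycles of length i remain after removal, there are i (c + 1) choices, which
  is the step from i^c c! to i^(c+1) (c+1)!. The bound \<open>M\<close> is decoupled from
  \<open>card A\<close> so that it survives the removal.\<close>

lemma card_intertwiners:
  assumes "finite A" "bij_betw f A A" "finite B" "bij_betw g B B"
    and "num_period A f = num_period B g" and "card A \<le> M"
  shows "card (intertwiners A f B g) = centralizer_size M (num_period A f)"
  using assms
proof (induction A arbitrary: B rule: finite_remove_cyc_induct)
  case empty
  have "B = {}"
  proof (rule ccontr)
    assume "B \<noteq> {}"
    then obtain b where "b \<in> B" by auto
    then have "card {x \<in> B. least_power g x = least_power g b} \<noteq> 0"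
      using empty by auto
    moreover have "num_period B g (least_power g b) = 0"
      using fun_cong[OF empty(3), of "least_power g b"] by (simp add: num_period_def)
    ultimately show False by (simp add: num_period_def)
  qed
  then have "intertwiners {} f B g = {id}"
    by (auto simp: intertwiners_def bij_betw_def)
  then show ?case by (simp add: centralizer_size_def num_period_def)
next
  case (remove A a)
  define i where "i = least_power f a"
  define B' where "B' = {b \<in> B. least_power g b = i}"
  have i: "0 < i" using bij_betw_least_power[OF remove(1-3)] by (auto simp: i_def)
  have "i \<le> card A"
    unfolding i_def using card_cyc[OF remove(1-3)] cyc_subset[OF remove(2,3)]
    by (metis card_mono remove(1))
  then have iM: "i \<in> {1..M}" using i remove.prems by auto
  have cB: "card B' = num_period A f i"
    using fun_cong[OF remove.prems(3), of i] by (simp add: num_period_def B'_def)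
  let ?e' = "num_period (A - cyc f a) f"
  have e: "num_period A f j = ?e' j + (if j = i then i else 0)" for j
    using num_period_Diff_cyc[OF remove(1-3)] by (simp add: i_def)
  have "intertwiners A f B g = (\<Union>b\<in>B'. {s \<in> intertwiners A f B g. s a = b})"
  proof -
    have "s a \<in> B'" if "s \<in> intertwiners A f B g" for s
      using least_power_intertwine[where s = s and g = g, OF remove(2) intertwinersD(2)[OF that]
          bij_betw_imp_inj_on[OF intertwinersD(1)[OF that]] remove(3)]
        bij_betwE[OF intertwinersD(1)[OF that]] remove(3)
      by (simp add: B'_def i_def)
    then show ?thesis by auto
  qed
  also have "card \<dots> = (\<Sum>b\<in>B'. card {s \<in> intertwiners A f B g. s a = b})"
    by (rule card_UN_disjoint)
      (use remove finite_intertwiners[of A B f g] in \<open>auto simp: B'_def\<close>)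
  also have "\<dots> = (\<Sum>b\<in>B'. centralizer_size M ?e')"
  proof (rule sum.cong)
    fix b assume "b \<in> B'"
    then have b: "b \<in> B" "least_power f a = least_power g b" by (auto simp: B'_def i_def)
    have "?e' j = num_period (B - cyc g b) g j" for j
      using num_period_Diff_cyc[OF remove(1-3), of j] num_period_Diff_cyc[OF remove(5,6) b(1), of j]
        fun_cong[OF remove.prems(3), of j] b by simp
    then have "?e' = num_period (B - cyc g b) g" by auto
    moreover have "card (A - cyc f a) \<le> M"
      using remove card_mono[of A "A - cyc f a"] by auto
    ultimately show "card {s \<in> intertwiners A f B g. s a = b} = centralizer_size M ?e'"
      using card_intertwiners_remove_cyc[OF remove(1-3) remove(5,6) b]
        remove.IH[of "B - cyc g b"] remove(5) bij_betw_Diff_cyc[OF remove(5,6) b(1)] by simp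
  qed simp
  also have "\<dots> = num_period A f i * centralizer_size M ?e'" by (simp add: cB)
  also have "\<dots> = centralizer_size M (num_period A f)"
  proof -
    \<comment> \<open>\<open>c\<close> is the number of cycles of length \<open>i\<close> other than
      the removed one; all other factors of the product are unchanged.\<close>
    obtain c where c: "?e' i = i * c"
      using dvd_num_period[of "A - cyc f a" f i] bij_betw_Diff_cyc[OF remove(1-3)] remove(1)
      by (auto simp: dvd_def)
    have ei: "num_period A f i = i * Suc c" using e[of i] c by simp
    have "(\<Prod>j\<in>{1..M} - {i}. j ^ (num_period A f j div j) * fact (num_period A f j div j)) =
          (\<Prod>j\<in>{1..M} - {i}. j ^ (?e' j div j) * fact (?e' j div j))"
      by (rule prod.cong) (auto simp: e)
    then show ?thesis
      unfolding centralizer_size_def prod.remove[OF finite_atLeastAtMost iM]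
      using i by (simp add: c ei algebra_simps)
  qed
  finally show ?case .
qed

section \<open>Double cosets\<close>

lemma sum_quotient:
  assumes "equiv X R" "finite X"
  shows "sum f X = (\<Sum>C\<in>X // R. sum f C)"
proof -
  have "sum f (\<Union>(X // R)) = (sum \<circ> sum) f (X // R)"
    using finite_equiv_class[OF assms(2) equiv_type[OF assms(1)]] quotient_disj[OF assms(1)]
    by (intro sum.Union_disjoint) blast+
  then show ?thesis by (simp add: Union_quotient[OF assms(1)])
qed

text \<open>No group structure on \<open>H\<close> is required. The hypothesis \<open>transp\<close>
  stands in for it: the elements taking x to y are as numerous as the stabilizer of y, so the
  stabilizer sizes over one class add up to \<open>card H\<close>.\<close>

lemma burnside_count:
  assumes R: "equiv X R" and fin: "finite X" "finite H"
    and act: "\<And>h x. h \<in> H \<Longrightarrow> x \<in> X \<Longrightarrow> (x, act h x) \<in> R"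
    and transp: "\<And>x y. (x, y) \<in> R \<Longrightarrow> card {h \<in> H. act h x = y} = card {h \<in> H. act h y = y}"
  shows "card (X // R) * card H = (\<Sum>h\<in>H. card {x \<in> X. act h x = x})"
proof -
  have class_sum: "(\<Sum>y\<in>C. card {h \<in> H. act h y = y}) = card H" if C: "C \<in> X // R" for C
  proof -
    obtain x where x: "x \<in> X" "C = R `` {x}" using C by (auto elim: quotientE)
    have finC: "finite C" using C R fin(1) finite_equiv_class by (metis equiv_type)
    have "H = (\<Union>y\<in>C. {h \<in> H. act h x = y})" using act x by auto
    then have "card H = card (\<Union>y\<in>C. {h \<in> H. act h x = y})" by simp
    also have "\<dots> = (\<Sum>y\<in>C. card {h \<in> H. act h x = y})"
      by (rule card_UN_disjoint) (use finC fin in auto)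
    also have "\<dots> = (\<Sum>y\<in>C. card {h \<in> H. act h y = y})"
      by (rule sum.cong) (use transp x in auto)
    finally show ?thesis by simp
  qed
  have "(\<Sum>h\<in>H. card {x \<in> X. act h x = x}) = (\<Sum>h\<in>H. \<Sum>x\<in>X. of_bool (act h x = x))"
    using fin by (simp add: Collect_conj_eq Int_commute)
  also have "\<dots> = (\<Sum>x\<in>X. \<Sum>h\<in>H. of_bool (act h x = x))" by (rule sum.swap)
  also have "\<dots> = (\<Sum>x\<in>X. card {h \<in> H. act h x = x})"
    using fin by (simp add: Collect_conj_eq Int_commute)
  also have "\<dots> = (\<Sum>C\<in>X // R. \<Sum>x\<in>C. card {h \<in> H. act h x = x})"
    by (rule sum_quotient[OF R fin(1)])
  also have "\<dots> = (\<Sum>C\<in>X // R. card H)" using class_sum by simp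
  finally show ?thesis by simp
qed

section \<open>The diagonal embedding and its double cosets\<close>

lemma finite_pairs [simp]: "finite (pairs d n)"
  by (simp add: pairs_def)

lemma card_pairs [simp]: "card (pairs d n) = n * d"
  by (simp add: pairs_def card_cartesian_product)

lemma diag_embed_comp: "diag_embed d (\<gamma> \<circ> \<delta>) = diag_embed d \<gamma> \<circ> diag_embed d \<delta>"
  by (auto simp: diag_embed_def fun_eq_iff)

lemma diag_embed_id [simp]: "diag_embed d id = id"
  by (auto simp: diag_embed_def fun_eq_iff)

lemma diag_embed_inv_comp:
  assumes "\<gamma> permutes A"
  shows "diag_embed d \<gamma> \<circ> diag_embed d (inv \<gamma>) = id" "diag_embed d (inv \<gamma>) \<circ> diag_embed d \<gamma> = id"
  using permutes_inv_o[OF assms] by (simp_all flip: diag_embed_comp)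

lemma diag_embed_permutes:
  assumes "\<gamma> permutes {1..n}"
  shows "diag_embed d \<gamma> permutes pairs d n"
proof (rule inj_imp_permutes)
  have "bij (diag_embed d \<gamma>)"
    using diag_embed_inv_comp[OF assms, of d] o_bij by blast
  then show "inj_on (diag_embed d \<gamma>) (pairs d n)"
    using bij_is_inj inj_on_subset by blast
  show "diag_embed d \<gamma> x \<in> pairs d n" if "x \<in> pairs d n" for x
  proof -
    obtain a \<alpha> where "x = (a, \<alpha>)" by (cases x)
    then show ?thesis
      using that permutes_in_image[OF assms, of a] unfolding pairs_def diag_embed_def by simp
  qed
  show "diag_embed d \<gamma> x = x" if "x \<notin> pairs d n" for x
  proof -
    obtain a \<alpha> where "x = (a, \<alpha>)" by (cases x)
    then show ?thesis
      using that permutes_not_in[OF assms, of a] unfolding pairs_def diag_embed_def by auto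
  qed
qed simp

lemma diag_embed_cancel:
  assumes "\<gamma> permutes A"
  shows "diag_embed d (inv \<gamma>) (diag_embed d \<gamma> x) = x" "diag_embed d \<gamma> (diag_embed d (inv \<gamma>) x) = x"
  using diag_embed_inv_comp[OF assms, THEN fun_cong, of d x] by simp_all

text \<open>Writing the right factor as an inverse turns two-sided multiplication into a left action
  of the pairs (\<gamma>, \<delta>).\<close>

lemma noncolor_rel_iff:
  "(\<sigma>, \<tau>) \<in> noncolor_rel d n \<longleftrightarrow> \<sigma> permutes pairs d n \<and> \<tau> permutes pairs d n \<and>
     (\<exists>\<gamma> \<delta>. \<gamma> permutes {1..n} \<and> \<delta> permutes {1..n} \<and> \<tau> = diag_embed d \<gamma> \<circ> \<sigma> \<circ> diag_embed d (inv \<delta>))"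
proof -
  have "(\<exists>\<delta>. \<delta> permutes {1..n} \<and> \<tau> = \<phi> \<circ> diag_embed d \<delta>) \<longleftrightarrow>
        (\<exists>\<delta>. \<delta> permutes {1..n} \<and> \<tau> = \<phi> \<circ> diag_embed d (inv \<delta>))" for \<phi>
    by (metis permutes_inv permutes_inv_inv)
  then show ?thesis
    unfolding noncolor_rel_def Sym_diag_def Sym_pairs_def by blast
qed

lemma equiv_noncolor_rel: "equiv (Sym_pairs d n) (noncolor_rel d n)"
proof (rule equivI)
  show "noncolor_rel d n \<subseteq> Sym_pairs d n \<times> Sym_pairs d n" by (auto simp: noncolor_rel_def)
  show "refl_on (Sym_pairs d n) (noncolor_rel d n)"
  proof (rule refl_onI)
    fix \<sigma> assume "\<sigma> \<in> Sym_pairs d n"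
    then show "(\<sigma>, \<sigma>) \<in> noncolor_rel d n"
      unfolding noncolor_rel_iff Sym_pairs_def
      by (auto intro!: exI[of _ id] simp: inv_id)
  qed
  show "sym (noncolor_rel d n)"
  proof (rule symI)
    fix \<sigma> \<tau> assume "(\<sigma>, \<tau>) \<in> noncolor_rel d n"
    then obtain \<gamma> \<delta> where *: "\<sigma> permutes pairs d n" "\<tau> permutes pairs d n"
      "\<gamma> permutes {1..n}" "\<delta> permutes {1..n}" "\<tau> = diag_embed d \<gamma> \<circ> \<sigma> \<circ> diag_embed d (inv \<delta>)"
      unfolding noncolor_rel_iff by blast
    have "\<sigma> = diag_embed d (inv \<gamma>) \<circ> \<tau> \<circ> diag_embed d (inv (inv \<delta>))"
      unfolding *(5) permutes_inv_inv[OF *(4)]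
      by (simp add: fun_eq_iff diag_embed_cancel[OF *(3)] diag_embed_cancel[OF *(4)])
    then show "(\<tau>, \<sigma>) \<in> noncolor_rel d n"
      unfolding noncolor_rel_iff using * permutes_inv by blast
  qed
  show "trans (noncolor_rel d n)"
  proof (rule transI)
    fix \<sigma> \<tau> \<upsilon> assume a: "(\<sigma>, \<tau>) \<in> noncolor_rel d n" "(\<tau>, \<upsilon>) \<in> noncolor_rel d n"
    obtain \<gamma> \<delta> where *: "\<sigma> permutes pairs d n"
      "\<gamma> permutes {1..n}" "\<delta> permutes {1..n}" "\<tau> = diag_embed d \<gamma> \<circ> \<sigma> \<circ> diag_embed d (inv \<delta>)"
      using a(1) unfolding noncolor_rel_iff by blast
    obtain \<gamma>' \<delta>' where **: "\<upsilon> permutes pairs d n"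
      "\<gamma>' permutes {1..n}" "\<delta>' permutes {1..n}" "\<upsilon> = diag_embed d \<gamma>' \<circ> \<tau> \<circ> diag_embed d (inv \<delta>')"
      using a(2) unfolding noncolor_rel_iff by blast
    have "inv (\<delta>' \<circ> \<delta>) = inv \<delta> \<circ> inv \<delta>'"
      using * ** by (intro o_inv_distrib) (auto intro: permutes_bij)
    then have "\<upsilon> = diag_embed d (\<gamma>' \<circ> \<gamma>) \<circ> \<sigma> \<circ> diag_embed d (inv (\<delta>' \<circ> \<delta>))"
      unfolding * ** diag_embed_comp by (simp add: diag_embed_comp o_assoc)
    then show "(\<sigma>, \<upsilon>) \<in> noncolor_rel d n"
      unfolding noncolor_rel_iff using * ** permutes_compose by metis
  qed
qed

lemma finite_Sym_pairs [simp]: "finite (Sym_pairs d n)"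
  unfolding Sym_pairs_def by (rule finite_permutations) simp

lemma permutes_commuting_eq_intertwiners:
  assumes "f permutes A" "g permutes A"
  shows "{\<sigma>. \<sigma> permutes A \<and> \<sigma> \<circ> f = g \<circ> \<sigma>} = intertwiners A f A g"
proof (intro subset_antisym subsetI)
  fix \<sigma> assume "\<sigma> \<in> {\<sigma>. \<sigma> permutes A \<and> \<sigma> \<circ> f = g \<circ> \<sigma>}"
  then show "\<sigma> \<in> intertwiners A f A g"
    unfolding intertwiners_def by (auto simp: fun_eq_iff permutes_imp_bij permutes_not_in)
next
  fix \<sigma> assume s: "\<sigma> \<in> intertwiners A f A g"
  have "\<sigma> (f x) = g (\<sigma> x)" for x
    using intertwinersD(2,3)[OF s, of x] permutes_not_in[OF assms(1)] permutes_not_in[OF assms(2)]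
    by (cases "x \<in> A") auto
  moreover have "\<sigma> permutes A"
    using intertwinersD[OF s] by (intro bij_imp_permutes)
  ultimately show "\<sigma> \<in> {\<sigma>. \<sigma> permutes A \<and> \<sigma> \<circ> f = g \<circ> \<sigma>}" by auto
qed

text \<open>A permutation \<sigma> is fixed by (\<gamma>, \<delta>) exactly when it carries the lift
  of \<delta> into the lift of \<gamma>, so the fixed points are intertwiners.\<close>

lemma Z_noncolor_burnside:
  "Z_noncolor d n * (fact n)\<^sup>2 =
     (\<Sum>\<gamma> | \<gamma> permutes {1..n}. \<Sum>\<delta> | \<delta> permutes {1..n}.
        card (intertwiners (pairs d n) (diag_embed d \<delta>) (pairs d n) (diag_embed d \<gamma>)))"
proof -
  let ?S = "{\<gamma>. \<gamma> permutes {1..n}}"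
  define act where "act = (\<lambda>(\<gamma>, \<delta>) \<sigma>. diag_embed d \<gamma> \<circ> \<sigma> \<circ> diag_embed d (inv \<delta>))"
  have finS: "finite ?S" by (rule finite_permutations) simp
  have "card (Sym_pairs d n // noncolor_rel d n) * card (?S \<times> ?S) =
        (\<Sum>h\<in>?S \<times> ?S. card {\<sigma> \<in> Sym_pairs d n. act h \<sigma> = \<sigma>})"
  proof (rule burnside_count[OF equiv_noncolor_rel])
    show "finite (?S \<times> ?S)" using finS by simp
    show "(\<sigma>, act h \<sigma>) \<in> noncolor_rel d n" if "h \<in> ?S \<times> ?S" "\<sigma> \<in> Sym_pairs d n" for h \<sigma>
    proof -
      obtain \<gamma> \<delta> where h: "h = (\<gamma>, \<delta>)" "\<gamma> permutes {1..n}" "\<delta> permutes {1..n}"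
        using \<open>h \<in> ?S \<times> ?S\<close> by auto
      have "act h \<sigma> permutes pairs d n"
        using that h unfolding act_def Sym_pairs_def
        by (auto intro!: permutes_compose diag_embed_permutes permutes_inv)
      then show ?thesis
        unfolding noncolor_rel_iff using that h by (auto simp: act_def Sym_pairs_def)
    qed
    fix \<sigma> \<tau> assume "(\<sigma>, \<tau>) \<in> noncolor_rel d n"
    then obtain \<gamma>0 \<delta>0 where *: "\<gamma>0 permutes {1..n}" "\<delta>0 permutes {1..n}"
      "\<tau> = diag_embed d \<gamma>0 \<circ> \<sigma> \<circ> diag_embed d (inv \<delta>0)"
      unfolding noncolor_rel_iff by blast
    have \<sigma>: "\<sigma> = diag_embed d (inv \<gamma>0) \<circ> \<tau> \<circ> diag_embed d \<delta>0"
      unfolding *(3) by (simp add: fun_eq_iff diag_embed_cancel[OF *(1)] diag_embed_cancel[OF *(2)])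
    have inv_comp: "inv (a \<circ> b) = inv b \<circ> inv a" if "a permutes {1..n}" "b permutes {1..n}" for a b
      using that by (intro o_inv_distrib) (auto intro: permutes_bij)
    \<comment> \<open>If (\<gamma>0, \<delta>0) takes \<sigma> to \<tau>, right translation by its
      inverse takes the elements moving \<sigma> to \<tau> onto the stabilizer of \<tau>.\<close>
    have "bij_betw (\<lambda>(\<gamma>, \<delta>). (\<gamma> \<circ> inv \<gamma>0, \<delta> \<circ> inv \<delta>0))
        {h \<in> ?S \<times> ?S. act h \<sigma> = \<tau>} {h \<in> ?S \<times> ?S. act h \<tau> = \<tau>}"
    proof (rule bij_betw_byWitness[where f' = "\<lambda>(\<gamma>, \<delta>). (\<gamma> \<circ> \<gamma>0, \<delta> \<circ> \<delta>0)"], goal_cases)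
      case 1
      show ?case using permutes_inv_o[OF *(1)] permutes_inv_o[OF *(2)] by (auto simp flip: o_assoc)
    next
      case 2
      show ?case using permutes_inv_o[OF *(1)] permutes_inv_o[OF *(2)] by (auto simp flip: o_assoc)
    next
      case 3
      show ?case
      proof (rule image_subsetI)
        fix h assume "h \<in> {h \<in> ?S \<times> ?S. act h \<sigma> = \<tau>}"
        then obtain \<gamma> \<delta> where h: "h = (\<gamma>, \<delta>)" "\<gamma> permutes {1..n}" "\<delta> permutes {1..n}"
          and e: "act (\<gamma>, \<delta>) \<sigma> = \<tau>" by auto
        have "\<gamma> \<circ> inv \<gamma>0 permutes {1..n}" "\<delta> \<circ> inv \<delta>0 permutes {1..n}"
          using h * by (auto intro: permutes_compose permutes_inv)
        moreover have "act (\<gamma> \<circ> inv \<gamma>0, \<delta> \<circ> inv \<delta>0) \<tau> = act (\<gamma>, \<delta>) \<sigma>"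
          unfolding \<sigma> act_def
          by (simp add: inv_comp[OF h(3) permutes_inv[OF *(2)]] permutes_inv_inv[OF *(2)]
              diag_embed_comp o_assoc)
        ultimately show "(case h of (\<gamma>, \<delta>) \<Rightarrow> (\<gamma> \<circ> inv \<gamma>0, \<delta> \<circ> inv \<delta>0)) \<in> {h \<in> ?S \<times> ?S. act h \<tau> = \<tau>}"
          using e h(1) by simp
      qed
    next
      case 4
      show ?case
      proof (rule image_subsetI)
        fix h assume "h \<in> {h \<in> ?S \<times> ?S. act h \<tau> = \<tau>}"
        then obtain \<gamma> \<delta> where h: "h = (\<gamma>, \<delta>)" "\<gamma> permutes {1..n}" "\<delta> permutes {1..n}"
          and e: "act (\<gamma>, \<delta>) \<tau> = \<tau>" by auto
        have "\<gamma> \<circ> \<gamma>0 permutes {1..n}" "\<delta> \<circ> \<delta>0 permutes {1..n}"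
          using h * by (auto intro: permutes_compose)
        moreover have "act (\<gamma> \<circ> \<gamma>0, \<delta> \<circ> \<delta>0) \<sigma> = act (\<gamma>, \<delta>) \<tau>"
          unfolding act_def *(3)
          by (simp add: inv_comp[OF h(3) *(2)] diag_embed_comp o_assoc)
        ultimately show "(case h of (\<gamma>, \<delta>) \<Rightarrow> (\<gamma> \<circ> \<gamma>0, \<delta> \<circ> \<delta>0)) \<in> {h \<in> ?S \<times> ?S. act h \<sigma> = \<tau>}"
          using e h(1) by simp
      qed
    qed
    then show "card {h \<in> ?S \<times> ?S. act h \<sigma> = \<tau>} = card {h \<in> ?S \<times> ?S. act h \<tau> = \<tau>}"
      by (rule bij_betw_same_card)
  qed simp
  also have "\<dots> = (\<Sum>\<gamma>\<in>?S. \<Sum>\<delta>\<in>?S. card {\<sigma> \<in> Sym_pairs d n. act (\<gamma>, \<delta>) \<sigma> = \<sigma>})"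
    by (simp add: sum.cartesian_product split_def)
  also have "\<dots> = (\<Sum>\<gamma>\<in>?S. \<Sum>\<delta>\<in>?S.
      card (intertwiners (pairs d n) (diag_embed d \<delta>) (pairs d n) (diag_embed d \<gamma>)))"
  proof (intro sum.cong refl)
    fix \<gamma> \<delta> assume "\<gamma> \<in> ?S" "\<delta> \<in> ?S"
    then have h: "\<gamma> permutes {1..n}" "\<delta> permutes {1..n}" by auto
    have "diag_embed d \<gamma> \<circ> \<sigma> \<circ> diag_embed d (inv \<delta>) = \<sigma> \<longleftrightarrow> \<sigma> \<circ> diag_embed d \<delta> = diag_embed d \<gamma> \<circ> \<sigma>" for \<sigma>
      unfolding fun_eq_iff o_apply using diag_embed_cancel[OF h(2)] by metis
    then show "card {\<sigma> \<in> Sym_pairs d n. act (\<gamma>, \<delta>) \<sigma> = \<sigma>} =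
        card (intertwiners (pairs d n) (diag_embed d \<delta>) (pairs d n) (diag_embed d \<gamma>))"
      unfolding permutes_commuting_eq_intertwiners[OF diag_embed_permutes[OF h(2)]
          diag_embed_permutes[OF h(1)], symmetric] act_def Sym_pairs_def by simp
  qed
  finally show ?thesis
    by (simp add: Z_noncolor_def card_cartesian_product card_permutations power2_eq_square)
qed

section \<open>Cycle types\<close>

lemma le_card_if_num_period_pos:
  assumes "finite A" "bij_betw f A A" "num_period A f i \<noteq> 0"
  shows "1 \<le> i" "i \<le> card A"
proof -
  have "{a \<in> A. least_power f a = i} \<noteq> {}" using assms by (auto simp: num_period_def)
  then obtain a where a: "a \<in> A" "least_power f a = i" by auto
  show "1 \<le> i" using bij_betw_least_power[OF assms(1,2) a(1)] a(2) by simp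
  show "i \<le> card A"
    using card_cyc[OF assms(1,2) a(1)] cyc_subset[OF assms(2) a(1)] a(2) card_mono assms(1) by metis
qed

text \<open>Every point a has d copies among the pairs, and each copy has the period of a.\<close>

lemma num_period_diag_embed:
  "num_period (pairs d n) (diag_embed d \<gamma>) i = d * num_period {1..n} \<gamma> i"
proof -
  have "(diag_embed d \<gamma> ^^ k) (a, \<alpha>) = ((\<gamma> ^^ k) a, \<alpha>)" if "\<alpha> \<in> {1..d}" for k a \<alpha>
    by (induction k) (use that in \<open>auto simp: diag_embed_def\<close>)
  then have "least_power (diag_embed d \<gamma>) (a, \<alpha>) = least_power \<gamma> a" if "\<alpha> \<in> {1..d}" for a \<alpha>
    using that unfolding least_power_def by simp
  then have "{x \<in> pairs d n. least_power (diag_embed d \<gamma>) x = i} =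
      {a \<in> {1..n}. least_power \<gamma> a = i} \<times> {1..d}"
    by (auto simp: pairs_def)
  then show ?thesis by (simp add: num_period_def card_cartesian_product)
qed

lemma centralizer_size_mono:
  assumes "\<And>i. n < i \<Longrightarrow> e i = 0" "n \<le> m"
  shows "centralizer_size m e = centralizer_size n e"
  unfolding centralizer_size_def
  by (rule prod.mono_neutral_right) (use assms in auto)

lemma card_intertwiners_diag_embed:
  assumes "\<gamma> permutes {1..n}" "\<delta> permutes {1..n}" "d \<ge> 1"
  shows "card (intertwiners (pairs d n) (diag_embed d \<gamma>) (pairs d n) (diag_embed d \<delta>)) =
    (if num_period {1..n} \<gamma> = num_period {1..n} \<delta>
     then centralizer_size n (\<lambda>i. d * num_period {1..n} \<gamma> i) else 0)"
proof -
  let ?P = "pairs d n"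
  have bij: "bij_betw (diag_embed d \<gamma>) ?P ?P" "bij_betw (diag_embed d \<delta>) ?P ?P"
    by (rule permutes_imp_bij[OF diag_embed_permutes[OF assms(1)]],
        rule permutes_imp_bij[OF diag_embed_permutes[OF assms(2)]])
  have np: "num_period ?P (diag_embed d \<gamma>) = (\<lambda>i. d * num_period {1..n} \<gamma> i)" for \<gamma>
    using num_period_diag_embed by auto
  show ?thesis
  proof (cases "num_period {1..n} \<gamma> = num_period {1..n} \<delta>")
    case True
    have "card (intertwiners ?P (diag_embed d \<gamma>) ?P (diag_embed d \<delta>)) =
        centralizer_size (n * d) (num_period ?P (diag_embed d \<gamma>))"
      by (rule card_intertwiners) (use bij np True in auto)
    \<comment> \<open>Although there are \<open>n * d\<close> pairs, no period exceeds
      \<open>n\<close>, so the factors beyond \<open>n\<close> are 1.\<close>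
    also have "\<dots> = centralizer_size n (\<lambda>i. d * num_period {1..n} \<gamma> i)"
      unfolding np
    proof (rule centralizer_size_mono)
      show "d * num_period {1..n} \<gamma> i = 0" if "n < i" for i
        using le_card_if_num_period_pos(2)[of "{1..n}" \<gamma> i] that permutes_imp_bij[OF assms(1)]
        by auto
    qed (use assms in simp)
    finally show ?thesis using True by simp
  next
    case False
    have "s \<notin> intertwiners ?P (diag_embed d \<gamma>) ?P (diag_embed d \<delta>)" for s
    proof
      assume s: "s \<in> intertwiners ?P (diag_embed d \<gamma>) ?P (diag_embed d \<delta>)"
      have "num_period ?P (diag_embed d \<gamma>) = num_period ?P (diag_embed d \<delta>)"
        by (rule num_period_intertwine[OF bij(1) intertwinersD(2)[OF s] intertwinersD(1)[OF s]])
      then have "num_period {1..n} \<gamma> i = num_period {1..n} \<delta> i" for i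
        using assms(3) fun_cong[of _ _ i] unfolding np by fastforce
      then show False using False by auto
    qed
    then have "intertwiners ?P (diag_embed d \<gamma>) ?P (diag_embed d \<delta>) = {}" by blast
    then show ?thesis using False by simp
  qed
qed

text \<open>Orbit and stabilizer: each permutation of \<open>A\<close> intertwines \<gamma>0 with
  exactly one permutation, its conjugate, and every permutation with the same periods arises equally
  often. The intertwiner sets thus split the symmetric group into equal parts.\<close>

lemma card_conjugacy_class:
  assumes A: "finite A" "\<gamma>0 permutes A"
  shows "card {\<gamma>. \<gamma> permutes A \<and> num_period A \<gamma> = num_period A \<gamma>0} *
           centralizer_size (card A) (num_period A \<gamma>0) = fact (card A)"
proof -
  let ?C = "{\<gamma>. \<gamma> permutes A \<and> num_period A \<gamma> = num_period A \<gamma>0}"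
  have finC: "finite ?C" using finite_permutations[OF A(1)] by (rule rev_finite_subset) auto
  have part: "{\<sigma>. \<sigma> permutes A} = (\<Union>\<gamma>\<in>?C. intertwiners A \<gamma>0 A \<gamma>)"
  proof (intro subset_antisym subsetI)
    fix \<sigma> assume "\<sigma> \<in> {\<sigma>. \<sigma> permutes A}"
    then have s: "\<sigma> permutes A" by simp
    define \<gamma> where "\<gamma> = \<sigma> \<circ> \<gamma>0 \<circ> inv \<sigma>"
    have p: "\<gamma> permutes A"
      unfolding \<gamma>_def by (intro permutes_compose permutes_inv s A)
    have "\<sigma> \<circ> \<gamma>0 = \<gamma> \<circ> \<sigma>"
      unfolding \<gamma>_def by (simp add: fun_eq_iff permutes_inverses[OF s])
    then have m: "\<sigma> \<in> intertwiners A \<gamma>0 A \<gamma>"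
      using s by (simp flip: permutes_commuting_eq_intertwiners[OF A(2) p])
    have "num_period A \<gamma>0 = num_period A \<gamma>"
      by (rule num_period_intertwine[OF permutes_imp_bij[OF A(2)] intertwinersD(2)[OF m] intertwinersD(1)[OF m]])
    then show "\<sigma> \<in> (\<Union>\<gamma>\<in>?C. intertwiners A \<gamma>0 A \<gamma>)" using m p by auto
  next
    fix \<sigma> assume "\<sigma> \<in> (\<Union>\<gamma>\<in>?C. intertwiners A \<gamma>0 A \<gamma>)"
    then obtain \<gamma> where g: "\<gamma> permutes A" "\<sigma> \<in> intertwiners A \<gamma>0 A \<gamma>" by auto
    show "\<sigma> \<in> {\<sigma>. \<sigma> permutes A}"
      using g(2) unfolding permutes_commuting_eq_intertwiners[OF A(2) g(1), symmetric] by blast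
  qed
  have "fact (card A) = card (\<Union>\<gamma>\<in>?C. intertwiners A \<gamma>0 A \<gamma>)"
    unfolding part[symmetric] by (rule card_permutations[OF refl A(1), symmetric])
  also have "\<dots> = (\<Sum>\<gamma>\<in>?C. card (intertwiners A \<gamma>0 A \<gamma>))"
  proof (rule card_UN_disjoint[OF finC])
    show "\<forall>\<gamma>\<in>?C. finite (intertwiners A \<gamma>0 A \<gamma>)" using finite_intertwiners[OF A(1) A(1)] by simp
    show "\<forall>\<gamma>\<in>?C. \<forall>\<delta>\<in>?C. \<gamma> \<noteq> \<delta> \<longrightarrow> intertwiners A \<gamma>0 A \<gamma> \<inter> intertwiners A \<gamma>0 A \<delta> = {}"
    proof (intro ballI impI)
      fix \<gamma> \<delta> assume c: "\<gamma> \<in> ?C" "\<delta> \<in> ?C" "\<gamma> \<noteq> \<delta>"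
      have "\<sigma> \<notin> intertwiners A \<gamma>0 A \<delta>" if "\<sigma> \<in> intertwiners A \<gamma>0 A \<gamma>" for \<sigma>
      proof
        assume "\<sigma> \<in> intertwiners A \<gamma>0 A \<delta>"
        then have *: "\<sigma> permutes A" "\<sigma> \<circ> \<gamma>0 = \<gamma> \<circ> \<sigma>" "\<sigma> \<circ> \<gamma>0 = \<delta> \<circ> \<sigma>"
          using that c permutes_commuting_eq_intertwiners[OF A(2), of \<gamma>]
            permutes_commuting_eq_intertwiners[OF A(2), of \<delta>] by blast+
        have "\<gamma> = \<gamma> \<circ> \<sigma> \<circ> inv \<sigma>" using permutes_inv_o(1)[OF *(1)] by (simp add: comp_assoc)
        also have "\<dots> = \<delta> \<circ> \<sigma> \<circ> inv \<sigma>" using * by simp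
        also have "\<dots> = \<delta>" using permutes_inv_o(1)[OF *(1)] by (simp add: comp_assoc)
        finally show False using c by simp
      qed
      then show "intertwiners A \<gamma>0 A \<gamma> \<inter> intertwiners A \<gamma>0 A \<delta> = {}" by blast
    qed
  qed
  also have "\<dots> = (\<Sum>\<gamma>\<in>?C. centralizer_size (card A) (num_period A \<gamma>0))"
    by (intro sum.cong refl card_intertwiners) (use A permutes_imp_bij in auto)
  finally show ?thesis by simp
qed

text \<open>The model consists of triples (length i of the cycle, number of the cycle among the
  \<open>p i\<close> of that length, position modulo i), and \<open>c\<close> advances the position.
  Any bijection onto \<open>B\<close> transports it.\<close>

lemma exists_permutation_num_period:
  fixes p :: "nat \<Rightarrow> nat"
  assumes "finite B" "card B = (\<Sum>i=1..n. i * p i)"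
  shows "\<exists>f. f permutes B \<and> (\<forall>i. num_period B f i = (if i \<in> {1..n} then i * p i else 0))"
proof -
  define A where "A = (SIGMA i:{1..n}. {..<p i} \<times> {..<i})"
  define c where "c = (\<lambda>(i::nat, j::nat, k). (i, j, Suc k mod i))"
  have finA: "finite A" by (auto simp: A_def)
  have cA: "card A = card B" unfolding assms(2) by (simp add: A_def card_cartesian_product mult.commute)
  have pow: "(c ^^ m) (i, j, k) = (i, j, (k + m) mod i)" if "k < i" for i j k m
    by (induction m) (use that in \<open>auto simp: c_def mod_Suc_eq\<close>)
  have lp: "least_power c (i, j, k) = i" if "k < i" for i j k
    unfolding least_power_def
  proof (rule Least_equality)
    show "(c ^^ i) (i, j, k) = (i, j, k) \<and> 0 < i" using that by (simp add: pow)
    fix m assume m: "(c ^^ m) (i, j, k) = (i, j, k) \<and> 0 < m"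
    then have "(k + m) mod i = (k + 0) mod i" using that by (simp add: pow)
    then have "i dvd m" using mod_eq_dvd_iff_nat[of k "k + m" i] by simp
    then show "i \<le> m" using m by (auto intro!: dvd_imp_le)
  qed
  have bc: "bij_betw c A A"
  proof -
    have "c ` A \<subseteq> A" by (auto simp: A_def c_def)
    moreover have "inj_on c A"
    proof (rule inj_onI)
      fix x y assume xy: "x \<in> A" "y \<in> A" "c x = c y"
      obtain i j k where x: "x = (i, j, k)" by (cases x)
      obtain i' j' k' where y: "y = (i', j', k')" by (cases y)
      have "i' = i" "j' = j" "k < i" "k' < i" "Suc k mod i = Suc k' mod i"
        using xy by (auto simp: A_def c_def x y)
      then show "x = y" by (auto simp: x y mod_Suc split: if_splits)
    qed
    ultimately show ?thesis using endo_inj_surj[OF finA] by (auto simp: bij_betw_def)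
  qed
  obtain h where h: "bij_betw h A B" using finite_same_card_bij[OF finA assms(1) cA] by blast
  define f where "f = (\<lambda>x. if x \<in> B then h (c (inv_into A h x)) else x)"
  have hf: "h (c x) = f (h x)" if "x \<in> A" for x
    using that h bij_betwE[OF h] by (simp add: f_def bij_betw_inv_into_left)
  have "num_period A c = num_period B f"
    by (rule num_period_intertwine[OF bc hf h])
  moreover have "num_period A c i = (if i \<in> {1..n} then i * p i else 0)" for i
  proof -
    have "{x \<in> A. least_power c x = i} = (if i \<in> {1..n} then {i} \<times> {..<p i} \<times> {..<i} else {})"
      by (auto simp: A_def lp split: if_splits)
    then show ?thesis by (simp add: num_period_def card_cartesian_product mult.commute)
  qed
  moreover have "f permutes B"
  proof (rule bij_imp_permutes)
    have "bij_betw (h \<circ> c \<circ> inv_into A h) B B"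
      using bij_betw_trans[OF bij_betw_trans[OF bij_betw_inv_into[OF h] bc] h] by (simp add: o_assoc)
    then show "bij_betw f B B"
      by (rule bij_betw_cong[THEN iffD1, rotated]) (simp add: f_def)
  qed (simp add: f_def)
  ultimately show ?thesis by metis
qed

section \<open>Cycle types as partitions, and the counting formula\<close>

definition cycle_type :: "nat \<Rightarrow> (nat \<Rightarrow> nat) \<Rightarrow> nat \<Rightarrow> nat" where
  "cycle_type n \<gamma> i = num_period {1..n} \<gamma> i div i"

lemma num_period_eq_cycle_type:
  assumes "\<gamma> permutes {1..n}"
  shows "num_period {1..n} \<gamma> i = i * cycle_type n \<gamma> i"
  using dvd_num_period[of "{1..n}" \<gamma> i] permutes_imp_bij[OF assms]
  by (simp add: cycle_type_def)

lemma sum_num_period: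
  assumes "finite A" "bij_betw f A A"
  shows "(\<Sum>i=1..card A. num_period A f i) = card A"
proof -
  have "card (\<Union>i\<in>{1..card A}. {a \<in> A. least_power f a = i}) = (\<Sum>i=1..card A. num_period A f i)"
    unfolding num_period_def by (rule card_UN_disjoint) (use assms in auto)
  moreover have "A = (\<Union>i\<in>{1..card A}. {a \<in> A. least_power f a = i})"
  proof -
    have "least_power f a \<in> {1..card A}" if "a \<in> A" for a
    proof -
      have "num_period A f (least_power f a) \<noteq> 0"
        unfolding num_period_def using that assms(1) by auto
      then show ?thesis using le_card_if_num_period_pos[OF assms] by auto
    qed
    then show ?thesis by auto
  qed
  ultimately show ?thesis by metis
qed

lemma cycle_type_image: "cycle_type n ` {\<gamma>. \<gamma> permutes {1..n}} = partitions_of n"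
proof (intro subset_antisym subsetI)
  fix p assume "p \<in> cycle_type n ` {\<gamma>. \<gamma> permutes {1..n}}"
  then obtain \<gamma> where g: "\<gamma> permutes {1..n}" "p = cycle_type n \<gamma>" by auto
  note b = permutes_imp_bij[OF g(1)]
  have "p i = 0" if "i \<notin> {1..n}" for i
    using that le_card_if_num_period_pos[OF _ b, of i] g
    by (cases "num_period {1..n} \<gamma> i = 0") (auto simp: cycle_type_def)
  moreover have "(\<Sum>i=1..n. i * p i) = n"
    using sum_num_period[OF _ b] num_period_eq_cycle_type[OF g(1)] unfolding g(2) by simp
  ultimately show "p \<in> partitions_of n" by (simp add: partitions_of_def)
next
  fix p assume p: "p \<in> partitions_of n"
  then have "card {1..n} = (\<Sum>i=1..n. i * p i)" by (simp add: partitions_of_def)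
  then obtain f where f: "f permutes {1..n}"
    "\<And>i. num_period {1..n} f i = (if i \<in> {1..n} then i * p i else 0)"
    using exists_permutation_num_period[where B = "{1..n}" and n = n and p = p, OF finite_atLeastAtMost] by blast
  have "cycle_type n f i = p i" for i
    using p unfolding cycle_type_def f(2) by (cases "i \<in> {1..n}") (auto simp: partitions_of_def)
  then have "cycle_type n f = p" by (rule ext)
  then show "p \<in> cycle_type n ` {\<gamma>. \<gamma> permutes {1..n}}" using f(1) by auto
qed

lemma real_Z_noncolor:
  assumes "d \<ge> 2"
  shows "real (Z_noncolor d n) = (\<Sum>p \<in> partitions_of n. \<Prod>i=1..n.
           real i ^ ((d - 2) * p i) * fact (d * p i) / (fact (p i))\<^sup>2)"
proof -
  let ?S = "{\<gamma>. \<gamma> permutes {1..n}}"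
  let ?C = "\<lambda>p. {\<gamma> \<in> ?S. cycle_type n \<gamma> = p}"
  \<comment> \<open>For type \<open>p\<close> there are \<open>d * (i * p i)\<close> pairs of period
    i, so \<open>?z d p\<close> is the order of the centralizer among permutations of the pairs, and
    \<open>?z 1 p\<close> the order of the one in the small group.\<close>
  let ?z = "\<lambda>d p. centralizer_size n (\<lambda>i. d * (i * p i))"
  have finS: "finite ?S" by (rule finite_permutations) simp
  have np: "num_period {1..n} \<gamma> = num_period {1..n} \<delta> \<longleftrightarrow> cycle_type n \<gamma> = cycle_type n \<delta>"
    if "\<gamma> \<in> ?S" "\<delta> \<in> ?S" for \<gamma> \<delta>
    using that num_period_eq_cycle_type[of \<gamma> n] num_period_eq_cycle_type[of \<delta> n]
    by (auto simp: fun_eq_iff cycle_type_def)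
  have npe: "num_period {1..n} \<gamma> = (\<lambda>i. i * cycle_type n \<gamma> i)" if "\<gamma> \<in> ?S" for \<gamma>
    using num_period_eq_cycle_type[of \<gamma> n] that by auto
  have z: "?z d p = (\<Prod>i=1..n. i ^ (d * p i) * fact (d * p i))" for d p
    unfolding centralizer_size_def
  proof (rule prod.cong)
    fix i assume "i \<in> {1..n}"
    then have "d * (i * p i) div i = d * p i"
      using nonzero_mult_div_cancel_left[of i "d * p i"] by (simp add: ac_simps)
    then show "i ^ (d * (i * p i) div i) * fact (d * (i * p i) div i) = i ^ (d * p i) * fact (d * p i)"
      by simp
  qed simp
  have conj_class: "card (?C p) * ?z 1 p = fact n" if "p \<in> partitions_of n" for p
  proof -
    have "p \<in> cycle_type n ` ?S" using that by (simp only: cycle_type_image)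
    then obtain \<gamma>0 where g: "\<gamma>0 \<in> ?S" "p = cycle_type n \<gamma>0" by (elim imageE)
    have "?C p = {\<gamma>. \<gamma> permutes {1..n} \<and> num_period {1..n} \<gamma> = num_period {1..n} \<gamma>0}"
      using np[OF _ g(1)] unfolding g(2) by blast
    then show ?thesis
      using card_conjugacy_class[of "{1..n}" \<gamma>0] g unfolding npe[OF g(1)] by simp
  qed
  have "Z_noncolor d n * (fact n)\<^sup>2 =
      (\<Sum>\<gamma>\<in>?S. \<Sum>\<delta>\<in>?S. if cycle_type n \<delta> = cycle_type n \<gamma> then ?z d (cycle_type n \<gamma>) else 0)"
    unfolding Z_noncolor_burnside
  proof (intro sum.cong refl)
    fix \<gamma> \<delta> assume g: "\<gamma> \<in> ?S" "\<delta> \<in> ?S"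
    have "card (intertwiners (pairs d n) (diag_embed d \<delta>) (pairs d n) (diag_embed d \<gamma>)) =
      (if num_period {1..n} \<delta> = num_period {1..n} \<gamma>
       then centralizer_size n (\<lambda>i. d * num_period {1..n} \<delta> i) else 0)"
      by (rule card_intertwiners_diag_embed) (use g assms in auto)
    note * = this[unfolded np[OF g(2,1)], unfolded npe[OF g(2)]]
    show "card (intertwiners (pairs d n) (diag_embed d \<delta>) (pairs d n) (diag_embed d \<gamma>)) =
      (if cycle_type n \<delta> = cycle_type n \<gamma> then ?z d (cycle_type n \<gamma>) else 0)"
      unfolding * by (rule if_cong) auto
  qed
  also have "\<dots> = (\<Sum>\<gamma>\<in>?S. card (?C (cycle_type n \<gamma>)) * ?z d (cycle_type n \<gamma>))"
  proof (rule sum.cong[OF refl])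
    fix \<gamma>
    have "(\<Sum>\<delta>\<in>?S. if cycle_type n \<delta> = cycle_type n \<gamma> then ?z d (cycle_type n \<gamma>) else 0) =
        (\<Sum>\<delta>\<in>?C (cycle_type n \<gamma>). ?z d (cycle_type n \<gamma>))"
      using finS by (rule sum.inter_filter[symmetric])
    then show "(\<Sum>\<delta>\<in>?S. if cycle_type n \<delta> = cycle_type n \<gamma> then ?z d (cycle_type n \<gamma>) else 0) =
        card (?C (cycle_type n \<gamma>)) * ?z d (cycle_type n \<gamma>)" by simp
  qed
  also have "\<dots> = (\<Sum>p\<in>cycle_type n ` ?S. \<Sum>\<gamma>\<in>?C p. card (?C (cycle_type n \<gamma>)) * ?z d (cycle_type n \<gamma>))"
    by (rule sum.image_gen[OF finS])
  also have "\<dots> = (\<Sum>p\<in>partitions_of n. card (?C p) * (card (?C p) * ?z d p))"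
    unfolding cycle_type_image
  proof (rule sum.cong[OF refl])
    fix p
    have "(\<Sum>\<gamma>\<in>?C p. card (?C (cycle_type n \<gamma>)) * ?z d (cycle_type n \<gamma>)) = (\<Sum>\<gamma>\<in>?C p. card (?C p) * ?z d p)"
      by (rule sum.cong) auto
    then show "(\<Sum>\<gamma>\<in>?C p. card (?C (cycle_type n \<gamma>)) * ?z d (cycle_type n \<gamma>)) = card (?C p) * (card (?C p) * ?z d p)"
      by simp
  qed
  finally have "real (Z_noncolor d n * (fact n)\<^sup>2) =
      (\<Sum>p\<in>partitions_of n. (real (card (?C p)))\<^sup>2 * real (?z d p))"
    by (simp add: power2_eq_square mult.assoc)
  then have "real (Z_noncolor d n) =
      (\<Sum>p\<in>partitions_of n. (real (card (?C p)))\<^sup>2 * real (?z d p) / (fact n)\<^sup>2)"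
    by (simp add: field_simps flip: sum_divide_distrib)
  also have "\<dots> = (\<Sum>p \<in> partitions_of n. \<Prod>i=1..n.
           real i ^ ((d - 2) * p i) * fact (d * p i) / (fact (p i))\<^sup>2)"
  proof (rule sum.cong)
    fix p assume p: "p \<in> partitions_of n"
    have c: "real (card (?C p)) * real (?z 1 p) = fact n"
      using arg_cong[OF conj_class[OF p], of real] by simp
    then have nz: "real (?z 1 p) \<noteq> 0" by (metis fact_nonzero mult_zero_right)
    have "(real (card (?C p)))\<^sup>2 * real (?z d p) / (fact n)\<^sup>2 = real (?z d p) / (real (?z 1 p))\<^sup>2"
      unfolding c[symmetric] using c nz by (auto simp: field_simps power2_eq_square)
    also have "\<dots> = (\<Prod>i=1..n. (real i ^ (d * p i) * fact (d * p i)) / (real i ^ p i * fact (p i))\<^sup>2)"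
      unfolding z by (simp add: prod_dividef prod.distrib flip: prod_power_distrib)
    also have "\<dots> = (\<Prod>i=1..n. real i ^ ((d - 2) * p i) * fact (d * p i) / (fact (p i))\<^sup>2)"
    proof (rule prod.cong)
      fix i assume i: "i \<in> {1..n}"
      \<comment> \<open>This is where \<open>d \<ge> 2\<close> matters: the subtraction is not
        truncated, and the two surplus powers cancel against the square of the small
        centralizer.\<close>
      have "d = (d - 2) + 2" using assms by simp
      then have "d * p i = ((d - 2) + 2) * p i" by (rule arg_cong)
      then have "d * p i = (d - 2) * p i + 2 * p i" by (simp only: add_mult_distrib)
      then have "real i ^ (d * p i) = real i ^ ((d - 2) * p i) * (real i ^ p i)\<^sup>2"
        by (simp add: power_add power_mult[symmetric] mult.commute)
      then show "(real i ^ (d * p i) * fact (d * p i)) / (real i ^ p i * fact (p i))\<^sup>2 =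
          real i ^ ((d - 2) * p i) * fact (d * p i) / (fact (p i))\<^sup>2"
        using i by (simp add: power_mult_distrib)
    qed simp
    finally show "(real (card (?C p)))\<^sup>2 * real (?z d p) / (fact n)\<^sup>2 =
      (\<Prod>i=1..n. real i ^ ((d - 2) * p i) * fact (d * p i) / (fact (p i))\<^sup>2)" .
  qed simp
  finally show ?thesis .
qed

section \<open>Tensor invariants of the unitary group\<close>

lemma unitary_group_iff:
  "g \<in> unitary_group N \<longleftrightarrow> g \<in> carrier_mat N N \<and>
     (\<forall>i<N. \<forall>j<N. (\<Sum>k<N. cnj (g $$ (k, i)) * g $$ (k, j)) = of_bool (i = j))"
proof -
  have "(mat_adjoint g * g) $$ (i, j) = (\<Sum>k<N. cnj (g $$ (k, i)) * g $$ (k, j))"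
    if "g \<in> carrier_mat N N" "i < N" "j < N" for i j
    using that by (simp add: mat_adjoint_def scalar_prod_def atLeast0LessThan mat_of_rows_index)
  then have "mat_adjoint g * g = 1\<^sub>m N \<longleftrightarrow>
      (\<forall>i<N. \<forall>j<N. (\<Sum>k<N. cnj (g $$ (k, i)) * g $$ (k, j)) = of_bool (i = j))"
    if "g \<in> carrier_mat N N"
    using that unfolding mat_eq_iff by (auto simp: mat_adjoint_def)
  then show ?thesis unfolding unitary_group_def by auto
qed

text \<open>Unitarity is defined through the columns; a left inverse of a square matrix is also a
  right inverse, which gives the rows.\<close>

lemma unitary_group_rows:
  assumes "g \<in> unitary_group N" "i < N" "j < N"
  shows "(\<Sum>k<N. g $$ (i, k) * cnj (g $$ (j, k))) = of_bool (i = j)"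
proof -
  have g: "g \<in> carrier_mat N N" "mat_adjoint g * g = 1\<^sub>m N"
    using assms(1) by (auto simp: unitary_group_def)
  have ad: "mat_adjoint g \<in> carrier_mat N N" using g(1) by (auto simp: mat_adjoint_def)
  have "g * mat_adjoint g = 1\<^sub>m N" by (rule mat_mult_left_right_inverse[OF ad g(1,2)])
  moreover have "(g * mat_adjoint g) $$ (i, j) = (\<Sum>k<N. g $$ (i, k) * cnj (g $$ (j, k)))"
    using g(1) assms by (simp add: mat_adjoint_def scalar_prod_def atLeast0LessThan mat_of_rows_index)
  moreover have "1\<^sub>m N $$ (i, j) = (of_bool (i = j) :: complex)" using assms by simp
  ultimately show ?thesis by metis
qed

abbreviation multi_index :: "'p set \<Rightarrow> nat \<Rightarrow> ('p \<Rightarrow> nat) set" where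
  "multi_index P N \<equiv> P \<rightarrow>\<^sub>E {..<N}"

text \<open>A tensor is read as a matrix with rows and columns indexed by multi-indices. The tensor
  positions form an arbitrary set \<open>P\<close>, so the study of invariants is kept apart from
  the grouping into n blocks of d.\<close>

definition U_invariant :: "'p set \<Rightarrow> nat \<Rightarrow> (('p \<Rightarrow> nat) \<Rightarrow> ('p \<Rightarrow> nat) \<Rightarrow> complex) \<Rightarrow> bool" where
  "U_invariant P N T \<longleftrightarrow> (\<forall>g\<in>unitary_group N. \<forall>x\<in>multi_index P N. \<forall>y\<in>multi_index P N.
     (\<Sum>x'\<in>multi_index P N. \<Sum>y'\<in>multi_index P N.
        (\<Prod>p\<in>P. g $$ (x p, x' p)) * (\<Prod>p\<in>P. cnj (g $$ (y p, y' p))) * T x' y') = T x y)"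

lemma finite_multi_index: "finite P \<Longrightarrow> finite (multi_index P N)"
  by (simp add: finite_PiE)

lemma prod_of_bool: "finite A \<Longrightarrow> (\<Prod>p\<in>A. of_bool (Q p) :: 'a :: comm_semiring_1) = of_bool (\<forall>p\<in>A. Q p)"
  by (induction rule: finite_induct) auto

lemma multi_index_eq_iff:
  "x \<in> multi_index P N \<Longrightarrow> y \<in> multi_index P N \<Longrightarrow> x = y \<longleftrightarrow> (\<forall>p\<in>P. x p = y p)"
  by (auto intro: PiE_ext)

text \<open>A sum over multi-indices of a product over positions factors into one column product for
  each position.\<close>

lemma tensor_power_columns:
  assumes "finite P" "g \<in> unitary_group N" "y \<in> multi_index P N" "u \<in> multi_index P N"
  shows "(\<Sum>z\<in>multi_index P N. (\<Prod>p\<in>P. g $$ (z p, y p)) * (\<Prod>p\<in>P. cnj (g $$ (z p, u p)))) = of_bool (u = y)"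
proof -
  have "(\<Sum>z\<in>multi_index P N. (\<Prod>p\<in>P. g $$ (z p, y p)) * (\<Prod>p\<in>P. cnj (g $$ (z p, u p)))) =
      (\<Prod>p\<in>P. \<Sum>k<N. cnj (g $$ (k, u p)) * g $$ (k, y p))"
    unfolding prod.distrib[symmetric] mult.commute[of "g $$ _"]
    by (rule prod_sum_PiE[symmetric]) (simp_all add: assms(1))
  also have "\<dots> = (\<Prod>p\<in>P. of_bool (u p = y p))"
  proof (rule prod.cong[OF refl])
    fix p assume "p \<in> P"
    then have "u p < N" "y p < N" using assms by auto
    then show "(\<Sum>k<N. cnj (g $$ (k, u p)) * g $$ (k, y p)) = of_bool (u p = y p)"
      using assms(2) unfolding unitary_group_iff by blast
  qed
  also have "\<dots> = of_bool (u = y)"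
    using assms by (simp add: prod_of_bool multi_index_eq_iff[OF assms(4,3)])
  finally show ?thesis .
qed

text \<open>Regarded as an operator, an invariant tensor commutes with \<open>g\<^sup>\<otimes>\<close>, so the vectors \<open>v\<close> with
  \<open>v\<^sup>T T = 0\<close> form a subrepresentation.\<close>

lemma U_invariant_row:
  assumes "finite P" "U_invariant P N T" "g \<in> unitary_group N"
    and "x \<in> multi_index P N" "y \<in> multi_index P N"
    and zero: "\<And>u. u \<in> multi_index P N \<Longrightarrow> T x u = 0"
  shows "(\<Sum>z\<in>multi_index P N. (\<Prod>p\<in>P. g $$ (x p, z p)) * T z y) = 0"
proof -
  let ?F = "multi_index P N"
  let ?G = "\<lambda>x z. \<Prod>p\<in>P. g $$ (x p, z p)" and ?H = "\<lambda>x z. \<Prod>p\<in>P. cnj (g $$ (x p, z p))"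
  have fin: "finite ?F" by (rule finite_multi_index[OF assms(1)])
  have inv: "(\<Sum>z\<in>?F. \<Sum>u\<in>?F. ?G x z * ?H v u * T z u) = T x v" if "v \<in> ?F" for v
    using assms(2,3,4) that unfolding U_invariant_def by blast
  \<comment> \<open>Row \<open>x\<close> is expanded by invariance and paired with column
    \<open>y\<close> of the tensor power of \<open>g\<close>; orthonormality of the columns then
    leaves only \<open>u = y\<close>.\<close>
  have "0 = (\<Sum>v\<in>?F. ?G v y * T x v)" using zero by simp
  also have "\<dots> = (\<Sum>v\<in>?F. \<Sum>z\<in>?F. \<Sum>u\<in>?F. ?G v y * (?G x z * ?H v u * T z u))"
    by (rule sum.cong) (simp_all add: inv[symmetric] sum_distrib_left)
  also have "\<dots> = (\<Sum>z\<in>?F. \<Sum>v\<in>?F. \<Sum>u\<in>?F. ?G v y * (?G x z * ?H v u * T z u))"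
    by (rule sum.swap)
  also have "\<dots> = (\<Sum>z\<in>?F. \<Sum>u\<in>?F. \<Sum>v\<in>?F. ?G v y * (?G x z * ?H v u * T z u))"
    by (intro sum.cong refl sum.swap)
  also have "\<dots> = (\<Sum>z\<in>?F. \<Sum>u\<in>?F. ?G x z * T z u * (\<Sum>v\<in>?F. ?G v y * ?H v u))"
    by (simp add: sum_distrib_left ac_simps)
  also have "\<dots> = (\<Sum>z\<in>?F. \<Sum>u\<in>?F. ?G x z * T z u * of_bool (u = y))"
    by (intro sum.cong refl) (simp add: tensor_power_columns[OF assms(1,3,5)])
  also have "\<dots> = (\<Sum>z\<in>?F. ?G x z * T z y)"
    by (rule sum.cong[OF refl], subst sum.remove[OF fin assms(5)]) (simp add: sum.neutral)
  finally show ?thesis by simp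
qed

text \<open>A permutation matrix with phases has one nonzero entry in each row, so the double sum in
  the invariance condition has a single term. With \<pi> the identity this gives torus invariance,
  with \<open>c\<close> constantly 1 invariance under permutation matrices.\<close>

lemma U_invariant_monomial:
  assumes P: "finite P" "U_invariant P N T" and "\<pi> permutes {..<N}" and c: "\<And>i. cnj (c i) * c i = 1"
    and xy: "x \<in> multi_index P N" "y \<in> multi_index P N"
  shows "T x y = (\<Prod>p\<in>P. c (x p)) * (\<Prod>p\<in>P. cnj (c (y p))) * T (\<lambda>p\<in>P. \<pi> (x p)) (\<lambda>p\<in>P. \<pi> (y p))"
proof -
  let ?F = "multi_index P N"
  define g where "g = mat N N (\<lambda>(i, j). if j = \<pi> i then c i else 0)"
  have \<pi>: "\<pi> i < N" if "i < N" for i using permutes_in_image[OF assms(3), of i] that by simp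
  have g: "g \<in> unitary_group N"
    unfolding unitary_group_iff
  proof (intro conjI allI impI)
    show "g \<in> carrier_mat N N" by (simp add: g_def)
    fix i j assume ij: "i < N" "j < N"
    have "(\<Sum>k<N. cnj (g $$ (k, i)) * g $$ (k, j)) = (\<Sum>k<N. of_bool (i = \<pi> k \<and> i = j))"
      using ij by (intro sum.cong refl) (auto simp: g_def c)
    also have "\<dots> = (\<Sum>k<N. of_bool (k = inv_into UNIV \<pi> i) * of_bool (i = j))"
      by (intro sum.cong refl) (use permutes_inverses[OF assms(3)] in auto)
    also have "\<dots> = of_bool (i = j)"
      using permutes_in_image[OF permutes_inv[OF assms(3)], of i] ij
      by (simp add: sum.remove[of "{..<N}" "inv_into UNIV \<pi> i"] sum.neutral)
    finally show "(\<Sum>k<N. cnj (g $$ (k, i)) * g $$ (k, j)) = of_bool (i = j)" .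
  qed
  have r: "(\<lambda>p\<in>P. \<pi> (x p)) \<in> ?F" if "x \<in> ?F" for x using that \<pi> by auto
  have G: "(\<Prod>p\<in>P. g $$ (x p, z p)) = (if z = (\<lambda>p\<in>P. \<pi> (x p)) then \<Prod>p\<in>P. c (x p) else 0)"
    if xz: "x \<in> ?F" "z \<in> ?F" for x z
  proof (cases "z = (\<lambda>p\<in>P. \<pi> (x p))")
    case True
    have "g $$ (x p, \<pi> (x p)) = c (x p)" if "p \<in> P" for p
    proof -
      have "x p < N" using \<open>x \<in> ?F\<close> that by auto
      then show ?thesis using \<pi> by (simp add: g_def)
    qed
    then show ?thesis using True by simp
  next
    case False
    then obtain p where p: "p \<in> P" "z p \<noteq> \<pi> (x p)"
      using multi_index_eq_iff[OF xz(2) r[OF xz(1)]] by auto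
    have "x p < N" "z p < N" using xz p(1) by auto
    then have "g $$ (x p, z p) = 0" using p(2) by (simp add: g_def)
    then show ?thesis using False p(1) P(1) by (auto intro!: prod_zero)
  qed
  have H: "(\<Prod>p\<in>P. cnj (g $$ (y p, z p))) = (if z = (\<lambda>p\<in>P. \<pi> (y p)) then \<Prod>p\<in>P. cnj (c (y p)) else 0)"
    if "y \<in> ?F" "z \<in> ?F" for y z
    using arg_cong[OF G[OF that], of cnj] by (simp add: cnj_prod split: if_splits)
  define X Y where "X = (\<lambda>p\<in>P. \<pi> (x p))" and "Y = (\<lambda>p\<in>P. \<pi> (y p))"
  have XY: "X \<in> ?F" "Y \<in> ?F" unfolding X_def Y_def using r xy by blast+
  have "T x y = (\<Sum>x'\<in>?F. \<Sum>y'\<in>?F. (\<Prod>p\<in>P. g $$ (x p, x' p)) * (\<Prod>p\<in>P. cnj (g $$ (y p, y' p))) * T x' y')"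
    using P(2) g xy unfolding U_invariant_def by simp
  also have "\<dots> = (\<Sum>x'\<in>?F. \<Sum>y'\<in>?F. if y' = Y then
      (if x' = X then (\<Prod>p\<in>P. c (x p)) * (\<Prod>p\<in>P. cnj (c (y p))) * T x' y' else 0) else 0)"
    by (intro sum.cong refl) (simp add: G[OF xy(1), folded X_def] H[OF xy(2), folded Y_def])
  also have "\<dots> = (\<Prod>p\<in>P. c (x p)) * (\<Prod>p\<in>P. cnj (c (y p))) * T X Y"
    using XY finite_multi_index[OF P(1)] by (simp add: sum.delta)
  finally show ?thesis unfolding X_def Y_def .
qed

text \<open>The angle 1 / (m + 1) is small enough that exponents up to \<open>m\<close> differ by a
  total angle below 1 in absolute value, where the sine vanishes only at 0. One phase therefore
  separates all these exponents.\<close>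

lemma cis_inverse_Suc_powers_inj:
  fixes a b m :: nat
  assumes "a \<le> m" "b \<le> m" and eq: "cis (1 / (real m + 1)) ^ a * cnj (cis (1 / (real m + 1)) ^ b) = 1"
  shows "a = b"
proof -
  let ?t = "(real a - real b) / (real m + 1)"
  have "cis (1 / (real m + 1)) ^ a * cnj (cis (1 / (real m + 1)) ^ b) = cis ?t"
    by (simp add: DeMoivre cis_cnj cis_mult diff_divide_distrib)
  then have s: "sin ?t = 0" using eq by (metis cis.simps(2) one_complex.simps(2))
  have "\<bar>?t\<bar> < 1" using assms by (simp add: field_simps)
  then have "- pi < ?t" "?t < pi" using pi_ge_two by linarith+
  then have "?t = 0" using s sin_eq_0_pi by blast
  then show ?thesis by (simp add: field_simps)
qed

text \<open>A phase t on the single coordinate \<open>e\<close> multiplies the entry by a power of t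
  for the occurrences of \<open>e\<close> in \<open>x\<close> and by a conjugate power for those in
  \<open>y\<close>; a nonzero entry forces the two to cancel.\<close>

lemma U_invariant_weight:
  assumes P: "finite P" "U_invariant P N T" and xy: "x \<in> multi_index P N" "y \<in> multi_index P N"
    and nz: "T x y \<noteq> 0"
  shows "card {p \<in> P. x p = e} = card {p \<in> P. y p = e}"
proof -
  define t where "t = cis (1 / (real (card P) + 1))"
  define c where "c = (\<lambda>i. if i = e then t else 1)"
  have r: "(\<lambda>p\<in>P. id (x p)) = x" if "x \<in> multi_index P N" for x :: "'a \<Rightarrow> nat"
    using that by (simp add: PiE_restrict)
  have pr: "(\<Prod>p\<in>P. c (x p)) = t ^ card {p \<in> P. x p = e}" for x
    using P(1) by (simp add: c_def prod.If_cases Int_def)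
  have "T x y = (\<Prod>p\<in>P. c (x p)) * (\<Prod>p\<in>P. cnj (c (y p))) * T x y"
    using U_invariant_monomial[OF P permutes_id, of c x y] xy
    by (simp only: r) (simp add: c_def t_def cis_cnj cis_mult)
  then have "(\<Prod>p\<in>P. c (x p)) * cnj (\<Prod>p\<in>P. c (y p)) = 1" using nz by (simp add: cnj_prod)
  then show ?thesis
    unfolding pr t_def
    by (intro cis_inverse_Suc_powers_inj[of _ "card P"]) (use P(1) in \<open>auto intro: card_mono\<close>)
qed

text \<open>The 2 by 2 Hadamard matrix in the coordinates \<open>e\<close>, \<open>f\<close> and the
  identity elsewhere. What counts later is that its block has no zero entry.\<close>

definition reflection :: "nat \<Rightarrow> nat \<Rightarrow> nat \<Rightarrow> complex mat" where
  "reflection N e f = mat N N (\<lambda>(i, j).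
     if i \<in> {e, f} \<and> j \<in> {e, f} then (if i = f \<and> j = f then - 1 else 1) / sqrt 2 else of_bool (i = j))"

lemma reflection_unitary:
  assumes "e < N" "f < N" "e \<noteq> f"
  shows "reflection N e f \<in> unitary_group N"
  unfolding unitary_group_iff
proof (intro conjI allI impI)
  show "reflection N e f \<in> carrier_mat N N" by (simp add: reflection_def)
  fix i j assume ij: "i < N" "j < N"
  let ?g = "reflection N e f"
  have sq: "complex_of_real (sqrt 2) * complex_of_real (sqrt 2) = 2"
    by (simp flip: of_real_mult)
  have "{..<N} = insert e (insert f ({..<N} - {e, f}))" using assms by auto
  then have "(\<Sum>k<N. cnj (?g $$ (k, i)) * ?g $$ (k, j)) = cnj (?g $$ (e, i)) * ?g $$ (e, j) +
      (cnj (?g $$ (f, i)) * ?g $$ (f, j) + (\<Sum>k\<in>{..<N} - {e, f}. cnj (?g $$ (k, i)) * ?g $$ (k, j)))"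
    using assms by (metis (no_types, lifting) Diff_iff finite_Diff finite_lessThan finite_insert insert_iff sum.insert)
  also have "(\<Sum>k\<in>{..<N} - {e, f}. cnj (?g $$ (k, i)) * ?g $$ (k, j)) =
      (\<Sum>k\<in>{..<N} - {e, f}. if k = i then of_bool (i = j) else 0)"
    using ij by (intro sum.cong refl) (auto simp: reflection_def)
  also have "\<dots> = of_bool (i = j \<and> i \<notin> {e, f})"
    using ij by (simp add: sum.delta)
  also have "cnj (?g $$ (e, i)) * ?g $$ (e, j) + (cnj (?g $$ (f, i)) * ?g $$ (f, j) + of_bool (i = j \<and> i \<notin> {e, f}))
      = of_bool (i = j)"
    using assms ij sq by (auto simp: reflection_def field_simps)
  finally show "(\<Sum>k<N. cnj (?g $$ (k, i)) * ?g $$ (k, j)) = of_bool (i = j)" .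
qed

text \<open>Applying a reflection in the plane of \<open>e\<close> and \<open>f\<close> to the row of \<open>x(k := f)\<close> yields all rows
  obtained by choosing \<open>e\<close> or \<open>f\<close> in the places where \<open>x\<close> has \<open>e\<close>; of these only the row of \<open>x\<close>
  itself has the weight of \<open>x\<close>.\<close>

lemma U_invariant_replace:
  assumes P: "finite P" "U_invariant P N T" and x: "x \<in> multi_index P N" and k: "k \<in> P"
    and f: "f < N" "f \<notin> x ` P"
    and zero: "\<And>u. u \<in> multi_index P N \<Longrightarrow> T (x(k := f)) u = 0"
    and y: "y \<in> multi_index P N"
  shows "T x y = 0"
proof (rule ccontr)
  assume nz: "T x y \<noteq> 0"
  let ?F = "multi_index P N"
  define e where "e = x k"
  define g where "g = reflection N e f"
  have e: "e < N" "e \<noteq> f" using x k f by (auto simp: e_def)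
  have g: "g \<in> unitary_group N" unfolding g_def by (rule reflection_unitary[OF e(1) f(1) e(2)])
  let ?x = "x(k := f)"
  have x': "?x \<in> ?F" using x k f by (auto simp: PiE_iff extensional_def)
  have x_lt: "x p < N" if "p \<in> P" for p using x that by auto
  have ind: "T z y = 0 \<or> (\<Prod>p\<in>P. g $$ (?x p, z p)) = 0" if z: "z \<in> ?F" "z \<noteq> x" for z
  proof (rule ccontr)
    assume "\<not> (T z y = 0 \<or> (\<Prod>p\<in>P. g $$ (?x p, z p)) = 0)"
    then have "T z y \<noteq> 0" and gz: "\<And>p. p \<in> P \<Longrightarrow> g $$ (?x p, z p) \<noteq> 0"
      unfolding prod_zero_iff[OF P(1)] by blast+
    \<comment> \<open>Nonzero entries in column \<open>y\<close> give \<open>z\<close> and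
      \<open>x\<close> the same weight, so \<open>f\<close>, absent from \<open>x\<close>, is absent
      from \<open>z\<close>. A nonzero matrix entry allows only \<open>e\<close> or \<open>f\<close>
      where \<open>x\<close> has \<open>e\<close>, and only the value of \<open>x\<close>
      elsewhere.\<close>
    have "card {p \<in> P. z p = f} = card {p \<in> P. x p = f}"
      by (rule trans[OF U_invariant_weight[where T = T, OF P z(1) y \<open>T z y \<noteq> 0\<close>]
            U_invariant_weight[where T = T, OF P x y nz, symmetric]])
    also have "{p \<in> P. x p = f} = {}" using f by auto
    finally have "{p \<in> P. z p = f} = {}" using P(1) by simp
    then have zf: "z p \<noteq> f" if "p \<in> P" for p using that by blast
    have "z p = x p" if p: "p \<in> P" for p
    proof -
      have "z p < N" using z p by auto
      then show ?thesis
        using gz[OF p] zf[OF p] x_lt[OF p] e f p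
        by (cases "p = k") (auto simp: g_def reflection_def e_def split: if_splits)
    qed
    then have "z = x" unfolding multi_index_eq_iff[OF z(1) x] by blast
    then show False using z(2) by simp
  qed
  have "(\<Sum>z\<in>?F. (\<Prod>p\<in>P. g $$ (?x p, z p)) * T z y) = 0"
    by (rule U_invariant_row[where T = T, OF P g x' y zero])
  moreover have "(\<Sum>z\<in>?F - {x}. (\<Prod>p\<in>P. g $$ (?x p, z p)) * T z y) = 0"
    by (rule sum.neutral) (use ind in auto)
  ultimately have "(\<Prod>p\<in>P. g $$ (?x p, x p)) * T x y = 0"
    using sum.remove[OF finite_multi_index[OF P(1)] x, of "\<lambda>z. (\<Prod>p\<in>P. g $$ (?x p, z p)) * T z y"] by simp
  \<comment> \<open>Each factor is an entry of the Hadamard block or a diagonal 1, so the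
    coefficient of the only surviving term is nonzero.\<close>
  moreover have "g $$ (?x p, x p) \<noteq> 0" if "p \<in> P" for p
    using x_lt[OF that] e f that by (auto simp: g_def reflection_def e_def)
  ultimately show False using nz unfolding mult_eq_0_iff prod_zero_iff[OF P(1)] by blast
qed

section \<open>Vanishing of an invariant tensor with one vanishing row\<close>

lemma extend_injection_to_permutation:
  assumes "finite B" "inj_on w P" "inj_on x P" "w ` P \<subseteq> B" "x ` P \<subseteq> B"
  shows "\<exists>\<pi>. \<pi> permutes B \<and> (\<forall>p\<in>P. \<pi> (w p) = x p)"
proof -
  have fin: "finite (w ` P)" "finite (x ` P)" using assms finite_subset by metis+
  have "card (w ` P) = card (x ` P)" using assms by (simp add: card_image)
  then have "card (B - w ` P) = card (B - x ` P)" using assms fin by (simp add: card_Diff_subset)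
  then have "\<exists>h. bij_betw h (B - w ` P) (B - x ` P)"
    using assms(1) by (intro finite_same_card_bij) simp_all
  then obtain h where h: "bij_betw h (B - w ` P) (B - x ` P)" ..
  define \<pi> where "\<pi> = (\<lambda>b. if b \<in> w ` P then x (inv_into P w b) else if b \<in> B then h b else b)"
  have \<pi>w: "\<pi> (w p) = x p" if "p \<in> P" for p using that assms(2) by (simp add: \<pi>_def)
  have "bij_betw (x \<circ> inv_into P w) (w ` P) (x ` P)"
    using assms by (intro bij_betw_trans[OF bij_betw_inv_into]) (auto simp: bij_betw_def)
  then have "bij_betw \<pi> (w ` P) (x ` P)"
    by (rule bij_betw_cong[THEN iffD1, rotated]) (simp add: \<pi>_def)
  moreover have "bij_betw \<pi> (B - w ` P) (B - x ` P)"
    using h by (rule bij_betw_cong[THEN iffD1, rotated]) (simp add: \<pi>_def)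
  ultimately have "bij_betw \<pi> (w ` P \<union> (B - w ` P)) (x ` P \<union> (B - x ` P))"
    by (rule bij_betw_combine) auto
  moreover have "w ` P \<union> (B - w ` P) = B" "x ` P \<union> (B - x ` P) = B" using assms by auto
  ultimately have "bij_betw \<pi> B B" by simp
  then have "\<pi> permutes B"
    by (rule bij_imp_permutes) (use assms(4) in \<open>auto simp: \<pi>_def\<close>)
  then show ?thesis using \<pi>w by blast
qed

text \<open>Induction on the number of values that \<open>x\<close> lacks for being injective. An
  injective \<open>x\<close> is the image of \<open>w\<close> under a permutation of the values.
  Otherwise one occurrence of a repeated value is replaced by a fresh one, and the row obtained
  vanishes by induction.\<close>

lemma U_invariant_eq_0:
  assumes P: "finite P" "U_invariant P N T" "card P \<le> N"
    and w: "w \<in> multi_index P N" "inj_on w P" "\<And>u. u \<in> multi_index P N \<Longrightarrow> T w u = 0"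
  shows "x \<in> multi_index P N \<Longrightarrow> y \<in> multi_index P N \<Longrightarrow> T x y = 0"
proof (induction "card P - card (x ` P)" arbitrary: x y rule: less_induct)
  case less
  show ?case
  proof (cases "inj_on x P")
    case True
    obtain \<pi> where \<pi>: "\<pi> permutes {..<N}" "\<And>p. p \<in> P \<Longrightarrow> \<pi> (w p) = x p"
      using extend_injection_to_permutation[of "{..<N}" w P x] True w less.prems by fastforce
    \<comment> \<open>The column that the permutation carries to \<open>y\<close> while it carries
      \<open>w\<close> to \<open>x\<close>.\<close>
    define v where "v = (\<lambda>p\<in>P. inv_into UNIV \<pi> (y p))"
    have v: "v \<in> multi_index P N"
      using less.prems permutes_in_image[OF permutes_inv[OF \<pi>(1)]] by (fastforce simp: v_def)
    have "(\<lambda>p\<in>P. \<pi> (w p)) = x" "(\<lambda>p\<in>P. \<pi> (v p)) = y"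
      using less.prems \<pi> permutes_inverses[OF \<pi>(1)]
      by (auto simp: v_def fun_eq_iff PiE_iff extensional_def)
    then show ?thesis
      using U_invariant_monomial[where T = T, OF P(1,2) \<pi>(1), of "\<lambda>_. 1", OF _ w(1) v] w(3)[OF v] by simp
  next
    case False
    then obtain k l where kl: "k \<in> P" "l \<in> P" "k \<noteq> l" "x k = x l" by (auto simp: inj_on_def)
    have lt: "card (x ` P) < card P"
      using False P(1) by (meson card_image_le eq_card_imp_inj_on le_neq_implies_less)
    then have "card (x ` P) < card {..<N}" using P(3) by simp
    then have "\<not> {..<N} \<subseteq> x ` P" using card_mono[of "x ` P" "{..<N}"] P(1) by auto
    then obtain f where f: "f < N" "f \<notin> x ` P" by auto
    \<comment> \<open>The old value at \<open>k\<close> survives at \<open>l\<close>, so the image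
      gains \<open>f\<close> and loses nothing.\<close>
    have "(x(k := f)) ` P = insert f (x ` P)"
      using kl by (auto simp: image_iff)
    then have "card ((x(k := f)) ` P) = Suc (card (x ` P))" using f(2) P(1) by simp
    then have m: "card P - card ((x(k := f)) ` P) < card P - card (x ` P)" using lt by simp
    have x': "x(k := f) \<in> multi_index P N"
      using less.prems(1) kl(1) f(1) by (auto simp: PiE_iff extensional_def)
    show ?thesis
      by (rule U_invariant_replace[where T = T, OF P(1,2) less.prems(1) kl(1) f _ less.prems(2)])
        (rule less.hyps[OF m x'])
  qed
qed

section \<open>Permutation tensors and the expansion of invariants in them\<close>

definition permuted :: "'p set \<Rightarrow> ('p \<Rightarrow> 'p) \<Rightarrow> ('p \<Rightarrow> nat) \<Rightarrow> ('p \<Rightarrow> nat) \<Rightarrow> bool" where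
  "permuted P \<sigma> x y \<longleftrightarrow> (\<forall>p\<in>P. y p = x (\<sigma> p))"

lemma permuted_restrict:
  "y \<in> multi_index P N \<Longrightarrow> permuted P \<sigma> x y \<longleftrightarrow> y = restrict (x \<circ> \<sigma>) P"
  by (auto simp: permuted_def fun_eq_iff PiE_iff extensional_def restrict_def)

lemma restrict_comp_in_multi_index:
  "\<sigma> permutes P \<Longrightarrow> x \<in> multi_index P N \<Longrightarrow> restrict (x \<circ> \<sigma>) P \<in> multi_index P N"
  using permutes_in_image by fastforce

text \<open>The tensor is a product of Kronecker deltas joining position p of \<open>y\<close> to
  position \<sigma>(p) of \<open>x\<close>. Summing over the intermediate index pairs each factor
  with a conjugate one, and orthonormality of the rows restores the deltas.\<close>

lemma U_invariant_permuted:
  assumes P: "finite P" "\<sigma> permutes P"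
  shows "U_invariant P N (\<lambda>x y. of_bool (permuted P \<sigma> x y))"
  unfolding U_invariant_def
proof (intro ballI)
  let ?F = "multi_index P N" and ?s = "inv_into UNIV \<sigma>"
  fix g x y assume g: "g \<in> unitary_group N" and xy: "x \<in> ?F" "y \<in> ?F"
  note fin = finite_multi_index[OF P(1), of N]
  have "(\<Sum>x'\<in>?F. \<Sum>y'\<in>?F. (\<Prod>p\<in>P. g $$ (x p, x' p)) * (\<Prod>p\<in>P. cnj (g $$ (y p, y' p))) *
      of_bool (permuted P \<sigma> x' y')) =
    (\<Sum>x'\<in>?F. \<Sum>y'\<in>?F. if y' = restrict (x' \<circ> \<sigma>) P
      then (\<Prod>p\<in>P. g $$ (x p, x' p)) * (\<Prod>p\<in>P. cnj (g $$ (y p, y' p))) else 0)"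
    by (intro sum.cong refl) (simp add: permuted_restrict)
  also have "\<dots> = (\<Sum>x'\<in>?F. (\<Prod>p\<in>P. g $$ (x p, x' p)) * (\<Prod>p\<in>P. cnj (g $$ (y p, x' (\<sigma> p)))))"
  proof (intro sum.cong refl)
    fix x' assume x': "x' \<in> ?F"
    show "(\<Sum>y'\<in>?F. if y' = restrict (x' \<circ> \<sigma>) P
        then (\<Prod>p\<in>P. g $$ (x p, x' p)) * (\<Prod>p\<in>P. cnj (g $$ (y p, y' p))) else 0) =
      (\<Prod>p\<in>P. g $$ (x p, x' p)) * (\<Prod>p\<in>P. cnj (g $$ (y p, x' (\<sigma> p))))"
      unfolding sum.delta[OF fin] if_P[OF restrict_comp_in_multi_index[OF P(2) x']] by simp
  qed
  also have "\<dots> = (\<Sum>x'\<in>?F. \<Prod>p\<in>P. g $$ (x p, x' p) * cnj (g $$ (y (?s p), x' p)))"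
  proof (intro sum.cong refl)
    fix x'
    have "(\<Prod>p\<in>P. cnj (g $$ (y p, x' (\<sigma> p)))) = (\<Prod>p\<in>P. cnj (g $$ (y (?s p), x' p)))"
      by (rule prod.reindex_bij_witness[of _ ?s \<sigma>])
        (use permutes_inverses[OF P(2)] permutes_in_image[OF P(2)] permutes_in_image[OF permutes_inv[OF P(2)]] in auto)
    then show "(\<Prod>p\<in>P. g $$ (x p, x' p)) * (\<Prod>p\<in>P. cnj (g $$ (y p, x' (\<sigma> p)))) =
      (\<Prod>p\<in>P. g $$ (x p, x' p) * cnj (g $$ (y (?s p), x' p)))"
      by (simp add: prod.distrib)
  qed
  also have "\<dots> = (\<Prod>p\<in>P. \<Sum>k<N. g $$ (x p, k) * cnj (g $$ (y (?s p), k)))"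
    by (rule prod_sum_PiE[symmetric]) (use P in auto)
  also have "\<dots> = (\<Prod>p\<in>P. of_bool (x p = y (?s p)))"
  proof (intro prod.cong refl unitary_group_rows[OF g])
    fix p assume "p \<in> P"
    moreover from this have "?s p \<in> P" using permutes_in_image[OF permutes_inv[OF P(2)]] by simp
    ultimately show "x p < N" "y (?s p) < N" using xy by auto
  qed
  also have "\<dots> = of_bool (\<forall>p\<in>P. x p = y (?s p))" using P(1) by (rule prod_of_bool)
  also have "(\<forall>p\<in>P. x p = y (?s p)) \<longleftrightarrow> permuted P \<sigma> x y"
    unfolding permuted_def
    using permutes_inverses[OF P(2)] permutes_in_image[OF P(2)] permutes_in_image[OF permutes_inv[OF P(2)]]
    by metis
  finally show "(\<Sum>x'\<in>?F. \<Sum>y'\<in>?F. (\<Prod>p\<in>P. g $$ (x p, x' p)) * (\<Prod>p\<in>P. cnj (g $$ (y p, y' p))) *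
      of_bool (permuted P \<sigma> x' y')) = of_bool (permuted P \<sigma> x y)" .
qed

lemma U_invariant_diff:
  assumes "U_invariant P N S" "U_invariant P N T"
  shows "U_invariant P N (\<lambda>x y. S x y - T x y)"
  using assms unfolding U_invariant_def by (simp add: right_diff_distrib sum_subtractf)

lemma U_invariant_sum:
  assumes "\<And>i. i \<in> I \<Longrightarrow> U_invariant P N (T i)"
  shows "U_invariant P N (\<lambda>x y. \<Sum>i\<in>I. c i * T i x y)"
  unfolding U_invariant_def
proof (intro ballI)
  let ?F = "multi_index P N"
  fix g x y assume a: "g \<in> unitary_group N" "x \<in> ?F" "y \<in> ?F"
  let ?G = "\<lambda>x' y'. (\<Prod>p\<in>P. g $$ (x p, x' p)) * (\<Prod>p\<in>P. cnj (g $$ (y p, y' p)))"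
  have "(\<Sum>x'\<in>?F. \<Sum>y'\<in>?F. ?G x' y' * (\<Sum>i\<in>I. c i * T i x' y')) =
      (\<Sum>x'\<in>?F. \<Sum>y'\<in>?F. \<Sum>i\<in>I. c i * (?G x' y' * T i x' y'))"
    by (intro sum.cong refl, subst sum_distrib_left, intro sum.cong refl) (rule mult.left_commute)
  also have "\<dots> = (\<Sum>x'\<in>?F. \<Sum>i\<in>I. \<Sum>y'\<in>?F. c i * (?G x' y' * T i x' y'))"
    by (intro sum.cong refl sum.swap)
  also have "\<dots> = (\<Sum>i\<in>I. \<Sum>x'\<in>?F. \<Sum>y'\<in>?F. c i * (?G x' y' * T i x' y'))"
    by (rule sum.swap)
  also have "\<dots> = (\<Sum>i\<in>I. c i * (\<Sum>x'\<in>?F. \<Sum>y'\<in>?F. ?G x' y' * T i x' y'))"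
    by (simp add: sum_distrib_left)
  also have "\<dots> = (\<Sum>i\<in>I. c i * T i x y)"
    by (intro sum.cong refl) (use assms a in \<open>simp add: U_invariant_def\<close>)
  finally show "(\<Sum>x'\<in>?F. \<Sum>y'\<in>?F. ?G x' y' * (\<Sum>i\<in>I. c i * T i x' y')) = (\<Sum>i\<in>I. c i * T i x y)" .
qed

text \<open>Distinct entries let \<open>w\<close> and its rearrangement determine the permutation;
  this is the source of linear independence.\<close>

lemma permuted_inj:
  assumes "inj_on w P" "\<sigma> permutes P" "\<tau> permutes P"
  shows "permuted P \<sigma> w (restrict (w \<circ> \<tau>) P) \<longleftrightarrow> \<sigma> = \<tau>"
proof
  assume a: "permuted P \<sigma> w (restrict (w \<circ> \<tau>) P)"
  have "\<sigma> p = \<tau> p" for p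
  proof (cases "p \<in> P")
    case True
    then have "w (\<tau> p) = w (\<sigma> p)" using a by (simp add: permuted_def)
    then show ?thesis
      using True assms(1) permutes_in_image[OF assms(2)] permutes_in_image[OF assms(3)]
      by (auto dest: inj_onD)
  qed (use assms permutes_not_in in metis)
  then show "\<sigma> = \<tau>" by auto
qed (simp add: permuted_def)

text \<open>A \<open>y\<close> of the same weight takes each value of \<open>w\<close> exactly once,
  so it is a rearrangement of \<open>w\<close>.\<close>

lemma weight_of_injective:
  assumes "finite P" "inj_on w P" "\<And>e. card {p \<in> P. w p = e} = card {p \<in> P. y p = e}"
  obtains \<sigma> where "\<sigma> permutes P" "permuted P \<sigma> w y"
proof -
  have le1: "card {p \<in> P. w p = e} \<le> 1" for e
    using assms(2) by (intro card_le_Suc0_iff_eq[THEN iffD2, unfolded One_nat_def[symmetric]])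
      (auto simp: assms(1) dest: inj_onD)
  have "y p \<in> w ` P" if "p \<in> P" for p
  proof -
    have "card {q \<in> P. y q = y p} \<noteq> 0" using that assms(1) by auto
    then have "{q \<in> P. w q = y p} \<noteq> {}" unfolding assms(3)[of "y p", symmetric] by force
    then obtain q where "q \<in> P" "w q = y p" by blast
    then show ?thesis by (metis image_eqI)
  qed
  then have img: "y ` P \<subseteq> w ` P" by auto
  have inj: "inj_on y P"
  proof (rule inj_onI)
    fix p q assume pq: "p \<in> P" "q \<in> P" "y p = y q"
    have "card {r \<in> P. y r = y p} \<le> 1" using le1[of "y p"] assms(3)[of "y p"] by simp
    then show "p = q" using pq assms(1) by (auto simp: card_le_Suc0_iff_eq)
  qed
  have "card (y ` P) = card (w ` P)" using inj assms(2) by (simp add: card_image)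
  then have eq: "y ` P = w ` P"
    by (rule card_subset_eq[OF finite_imageI[OF assms(1)] img])
  define \<sigma> where "\<sigma> = (\<lambda>p. if p \<in> P then inv_into P w (y p) else p)"
  have "bij_betw (inv_into P w \<circ> y) P P"
    using inj assms(2) eq by (intro bij_betw_trans[OF _ bij_betw_inv_into]) (auto simp: bij_betw_def)
  then have "bij_betw \<sigma> P P" by (rule bij_betw_cong[THEN iffD1, rotated]) (simp add: \<sigma>_def)
  then have "\<sigma> permutes P" by (rule bij_imp_permutes) (simp add: \<sigma>_def)
  moreover have "permuted P \<sigma> w y"
    unfolding permuted_def \<sigma>_def using img by (auto simp: f_inv_into_f)
  ultimately show ?thesis by (rule that)
qed

text \<open>At \<open>w\<close> and its rearrangement by \<sigma> only the tensor of \<sigma> is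
  nonzero, which dictates the coefficient. The difference then has a zero row at \<open>w\<close>,
  since entries at other columns vanish by weight.\<close>

theorem U_invariant_expansion:
  assumes P: "finite P" "U_invariant P N T" "card P \<le> N" and w: "w \<in> multi_index P N" "inj_on w P"
    and xy: "x \<in> multi_index P N" "y \<in> multi_index P N"
  shows "T x y = (\<Sum>\<sigma> | \<sigma> permutes P. T w (restrict (w \<circ> \<sigma>) P) * of_bool (permuted P \<sigma> x y))"
proof -
  let ?S = "\<lambda>x y. \<Sum>\<sigma> | \<sigma> permutes P. T w (restrict (w \<circ> \<sigma>) P) * of_bool (permuted P \<sigma> x y)"
  have inv: "U_invariant P N (\<lambda>x y. T x y - ?S x y)"
    by (intro U_invariant_diff U_invariant_sum P(2) U_invariant_permuted[OF P(1)]) simp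
  have fin: "finite {\<sigma>. \<sigma> permutes P}" using P(1) by (rule finite_permutations)
  have "T w u - ?S w u = 0" if u: "u \<in> multi_index P N" for u
  proof (cases "\<exists>\<sigma>. \<sigma> permutes P \<and> permuted P \<sigma> w u")
    case True
    then obtain \<tau> where t: "\<tau> permutes P" "u = restrict (w \<circ> \<tau>) P" using u permuted_restrict by metis
    have "?S w u = (\<Sum>\<sigma> | \<sigma> permutes P. if \<sigma> = \<tau> then T w (restrict (w \<circ> \<sigma>) P) else 0)"
      unfolding t(2) by (intro sum.cong refl) (simp add: permuted_inj[OF w(2) _ t(1)])
    then show ?thesis using fin t by simp
  next
    case False
    then have "?S w u = 0" by (intro sum.neutral) auto
    moreover have "T w u = 0"
    proof (rule ccontr)
      assume "T w u \<noteq> 0"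
      then have "card {p \<in> P. w p = e} = card {p \<in> P. u p = e}" for e
        by (rule U_invariant_weight[where T = T, OF P(1,2) w(1) u])
      then show False using weight_of_injective[OF P(1) w(2)] False by metis
    qed
    ultimately show ?thesis by simp
  qed
  then have "T x y - ?S x y = 0"
    by (rule U_invariant_eq_0[where T = "\<lambda>x y. T x y - ?S x y", OF P(1) inv P(3) w _ xy])
  then show ?thesis by simp
qed

lemma sum_fun_apply: "(\<Sum>i\<in>A. f i) x = (\<Sum>i\<in>A. f i x)"
  for f :: "'i \<Rightarrow> 'x \<Rightarrow> 'a :: comm_monoid_add"
  by (induction A rule: infinite_finite_induct) simp_all

section \<open>Symmetric tensors\<close>

lemma finite_tuples: "finite I \<Longrightarrow> finite (tuples m I)"
  unfolding tuples_def using finite_lists_length_eq[of I m] by (simp add: conj_commute)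

lemma permute_list_in_tuples:
  "\<pi> permutes {..<m} \<Longrightarrow> xs \<in> tuples m I \<Longrightarrow> permute_list \<pi> xs \<in> tuples m I"
  by (auto simp: tuples_def)

lemma permute_list_inv:
  assumes "\<pi> permutes {..<m}" "xs \<in> tuples m I"
  shows "permute_list (inv_into UNIV \<pi>) (permute_list \<pi> xs) = xs"
    "permute_list \<pi> (permute_list (inv_into UNIV \<pi>) xs) = xs"
proof -
  have l: "length xs = m" using assms by (simp add: tuples_def)
  note i = permutes_inv[OF assms(1)]
  show "permute_list (inv_into UNIV \<pi>) (permute_list \<pi> xs) = xs"
    using permute_list_compose[of "inv_into UNIV \<pi>" xs \<pi>] i l permutes_inv_o[OF assms(1)] by simp
  show "permute_list \<pi> (permute_list (inv_into UNIV \<pi>) xs) = xs"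
    using permute_list_compose[of \<pi> xs "inv_into UNIV \<pi>"] assms(1) l permutes_inv_o[OF assms(1)] by simp
qed

text \<open>This is n! times the symmetrization of the basis vector \<open>x\<close>. Permutations
  fixing \<open>x\<close> are counted with multiplicity, which makes the sum over all
  \<open>x\<close> constant.\<close>

definition orbit_tensor :: "nat \<Rightarrow> 'i list \<Rightarrow> 'i list \<Rightarrow> complex" where
  "orbit_tensor n x u = (\<Sum>\<pi> | \<pi> permutes {..<n}. of_bool (u = permute_list \<pi> x))"

lemma orbit_tensor_nonzero:
  "orbit_tensor n x u \<noteq> 0 \<Longrightarrow> \<exists>\<pi>. \<pi> permutes {..<n} \<and> u = permute_list \<pi> x"
  unfolding orbit_tensor_def using sum.not_neutral_contains_not_neutral by fastforce

lemma orbit_tensor_in_Sym_power: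
  assumes "x \<in> tuples n I"
  shows "orbit_tensor n x \<in> Sym_power n I"
  unfolding Sym_power_def coord_space_def
proof (intro CollectI conjI allI impI ballI)
  fix u assume "u \<notin> tuples n I"
  then show "orbit_tensor n x u = 0"
    using orbit_tensor_nonzero permute_list_in_tuples assms by metis
next
  fix \<rho> u assume \<rho>: "\<rho> permutes {..<n}" and u: "u \<in> tuples n I"
  let ?r = "inv_into UNIV \<rho>"
  note ri = permutes_inv[OF \<rho>]
  have len: "length x = n" using assms by (simp add: tuples_def)
  have eq: "permute_list \<rho> u = permute_list \<pi> x \<longleftrightarrow> u = permute_list (\<pi> \<circ> ?r) x"
    if "\<pi> permutes {..<n}" for \<pi>
    using permute_list_compose[of ?r x \<pi>] ri len permute_list_inv[OF \<rho> u]
      permute_list_inv[OF \<rho> permute_list_in_tuples[OF that assms]] by metis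
  show "orbit_tensor n x (permute_list \<rho> u) = orbit_tensor n x u"
    unfolding orbit_tensor_def
  proof (rule sum.reindex_bij_witness[of _ "\<lambda>\<pi>. \<pi> \<circ> \<rho>" "\<lambda>\<pi>. \<pi> \<circ> ?r"])
    fix \<pi> assume "\<pi> \<in> {\<pi>. \<pi> permutes {..<n}}"
    then have p: "\<pi> permutes {..<n}" by simp
    show "\<pi> \<circ> ?r \<in> {\<pi>. \<pi> permutes {..<n}}" "\<pi> \<circ> \<rho> \<in> {\<pi>. \<pi> permutes {..<n}}"
      using permutes_compose[OF ri p] permutes_compose[OF \<rho> p] by simp_all
    show "\<pi> \<circ> ?r \<circ> \<rho> = \<pi>" "\<pi> \<circ> \<rho> \<circ> ?r = \<pi>"
      by (simp_all add: comp_assoc permutes_inv_o[OF \<rho>])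
    show "of_bool (u = permute_list (\<pi> \<circ> ?r) x) = of_bool (permute_list \<rho> u = permute_list \<pi> x)"
      by (simp add: eq[OF p])
  qed
qed

text \<open>For every \<pi> exactly one \<open>x\<close> is carried to \<open>u\<close>.\<close>

lemma sum_orbit_tensor:
  assumes "finite I" "u \<in> tuples n I"
  shows "(\<Sum>x\<in>tuples n I. orbit_tensor n x u) = fact n"
proof -
  have "(\<Sum>x\<in>tuples n I. orbit_tensor n x u) =
      (\<Sum>\<pi> | \<pi> permutes {..<n}. \<Sum>x\<in>tuples n I. of_bool (u = permute_list \<pi> x))"
    unfolding orbit_tensor_def by (rule sum.swap)
  also have "\<dots> = (\<Sum>\<pi> | \<pi> permutes {..<n}. 1)"
  proof (rule sum.cong[OF refl])
    fix \<pi> assume "\<pi> \<in> {\<pi>. \<pi> permutes {..<n}}"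
    then have p: "\<pi> permutes {..<n}" by simp
    let ?u = "permute_list (inv_into UNIV \<pi>) u"
    have mem: "?u \<in> tuples n I" by (rule permute_list_in_tuples[OF permutes_inv[OF p] assms(2)])
    have "(\<Sum>x\<in>tuples n I. of_bool (u = permute_list \<pi> x) :: complex) = (\<Sum>x\<in>tuples n I. if x = ?u then 1 else 0)"
    proof (rule sum.cong[OF refl])
      fix x assume "x \<in> tuples n I"
      then have "u = permute_list \<pi> x \<longleftrightarrow> x = ?u"
        using permute_list_inv[OF p assms(2)] permute_list_inv[OF p] by metis
      then show "of_bool (u = permute_list \<pi> x) = (if x = ?u then 1 else 0 :: complex)" by simp
    qed
    then show "(\<Sum>x\<in>tuples n I. of_bool (u = permute_list \<pi> x) :: complex) = 1"
      using finite_tuples[OF assms(1)] mem by simp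
  qed
  also have "\<dots> = fact n" by (simp add: card_permutations)
  finally show ?thesis .
qed

text \<open>For the converse, a symmetric \<open>T\<close> is written through products of orbit
  tensors with coefficients \<open>T (x, y)\<close> over the square of n!. Wherever such a product
  is nonzero at (u, v), symmetry gives \<open>T (x, y) = T (u, v)\<close>, and the remaining sum is
  that square.\<close>

lemma tensor_Sym_power_iff:
  assumes "finite I" "finite J"
  shows "T \<in> tensor_subspace (Sym_power n I) (Sym_power n J) \<longleftrightarrow>
    T \<in> coord_space (tuples n I \<times> tuples n J) \<and>
    (\<forall>\<pi> \<rho>. \<pi> permutes {..<n} \<longrightarrow> \<rho> permutes {..<n} \<longrightarrow>
      (\<forall>x\<in>tuples n I. \<forall>y\<in>tuples n J. T (permute_list \<pi> x, permute_list \<rho> y) = T (x, y)))"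
    (is "_ \<longleftrightarrow> ?C T \<and> ?S T")
proof
  assume T: "T \<in> tensor_subspace (Sym_power n I) (Sym_power n J)"
  have "tensor_subspace (Sym_power n I) (Sym_power n J) \<subseteq> {T. ?C T \<and> ?S T}"
    unfolding tensor_subspace_def
  proof (rule fun_space.span_minimal)
    show "{\<lambda>(x, y). s x * t y |s t. s \<in> Sym_power n I \<and> t \<in> Sym_power n J} \<subseteq> {T. ?C T \<and> ?S T}"
      by (auto simp: Sym_power_def coord_space_def)
    show "fun_space.subspace {T. ?C T \<and> ?S T}"
      by (rule fun_space.subspaceI) (auto simp: coord_space_def)
  qed
  then show "?C T \<and> ?S T" using T by blast
next
  assume T: "?C T \<and> ?S T"
  let ?A = "tuples n I" and ?B = "tuples n J"
  let ?t = "\<lambda>x y. (\<lambda>(u, v). orbit_tensor n x u * orbit_tensor n y v)"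
  have "T = (\<Sum>x\<in>?A. \<Sum>y\<in>?B. (\<lambda>z. (T (x, y) / (fact n)\<^sup>2) * ?t x y z))"
  proof
    fix z :: "'a list \<times> 'b list"
    obtain u v where z: "z = (u, v)" by (cases z)
    have "(\<Sum>x\<in>?A. \<Sum>y\<in>?B. (\<lambda>z. (T (x, y) / (fact n)\<^sup>2) * ?t x y z)) z =
        (\<Sum>x\<in>?A. \<Sum>y\<in>?B. T (x, y) / (fact n)\<^sup>2 * (orbit_tensor n x u * orbit_tensor n y v))"
      by (simp add: sum_fun_apply z)
    also have "\<dots> = (\<Sum>x\<in>?A. \<Sum>y\<in>?B. T (u, v) / (fact n)\<^sup>2 * (orbit_tensor n x u * orbit_tensor n y v))"
    proof (intro sum.cong refl)
      fix x y assume xy: "x \<in> ?A" "y \<in> ?B"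
      show "T (x, y) / (fact n)\<^sup>2 * (orbit_tensor n x u * orbit_tensor n y v) =
          T (u, v) / (fact n)\<^sup>2 * (orbit_tensor n x u * orbit_tensor n y v)"
      proof (cases "orbit_tensor n x u = 0 \<or> orbit_tensor n y v = 0")
        case False
        then obtain \<pi> \<rho> where "\<pi> permutes {..<n}" "u = permute_list \<pi> x"
          "\<rho> permutes {..<n}" "v = permute_list \<rho> y"
          using orbit_tensor_nonzero by meson
        then have "T (u, v) = T (x, y)" using T xy by blast
        then show ?thesis by simp
      qed auto
    qed
    also have "\<dots> = T (u, v) / (fact n)\<^sup>2 * (\<Sum>x\<in>?A. \<Sum>y\<in>?B. orbit_tensor n x u * orbit_tensor n y v)"
      by (simp only: sum_distrib_left)
    also have "\<dots> = T (u, v) / (fact n)\<^sup>2 * ((\<Sum>x\<in>?A. orbit_tensor n x u) * (\<Sum>y\<in>?B. orbit_tensor n y v))"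
      by (simp only: sum_product)
    also have "\<dots> = T z"
    proof (cases "u \<in> ?A \<and> v \<in> ?B")
      case True
      then show ?thesis using assms by (simp add: sum_orbit_tensor z power2_eq_square)
    next
      case False
      then have "T (u, v) = 0" using T by (auto simp: coord_space_def)
      then show ?thesis by (simp add: z)
    qed
    finally show "T z = (\<Sum>x\<in>?A. \<Sum>y\<in>?B. (\<lambda>z. (T (x, y) / (fact n)\<^sup>2) * ?t x y z)) z" by simp
  qed
  also have "\<dots> \<in> tensor_subspace (Sym_power n I) (Sym_power n J)"
    unfolding tensor_subspace_def
  proof (intro fun_space.span_sum fun_space.span_scale fun_space.span_base)
    fix x y assume xy: "x \<in> ?A" "y \<in> ?B"
    show "?t x y \<in> {\<lambda>(x, y). s x * t y |s t. s \<in> Sym_power n I \<and> t \<in> Sym_power n J}"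
      by (intro CollectI, rule exI[of _ "orbit_tensor n x"], rule exI[of _ "orbit_tensor n y"])
        (simp add: orbit_tensor_in_Sym_power xy)
  qed
  finally show "T \<in> tensor_subspace (Sym_power n I) (Sym_power n J)" .
qed

section \<open>Invariants as functions of multi-indices\<close>

text \<open>List positions are counted from 0 and pairs from 1, hence the shifts. Restriction to
  \<open>pairs d n\<close> gives an extensional function, so that \<open>array\<close> is an inverse
  on the basis.\<close>

definition entry :: "nat \<Rightarrow> nat \<Rightarrow> nat list list \<Rightarrow> nat \<times> nat \<Rightarrow> nat" where
  "entry d n xs = (\<lambda>(a, \<alpha>)\<in>pairs d n. xs ! (a - 1) ! (\<alpha> - 1))"

definition array :: "nat \<Rightarrow> nat \<Rightarrow> (nat \<times> nat \<Rightarrow> nat) \<Rightarrow> nat list list" where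
  "array d n x = map (\<lambda>a. map (\<lambda>\<alpha>. x (Suc a, Suc \<alpha>)) [0..<d]) [0..<n]"

lemma tensor_basis_iff:
  "xs \<in> tensor_basis d n N \<longleftrightarrow>
     length xs = n \<and> (\<forall>a<n. length (xs ! a) = d \<and> (\<forall>\<alpha><d. xs ! a ! \<alpha> < N))"
  unfolding tensor_basis_def tuples_def by (fastforce simp: set_conv_nth subset_iff)

lemma entry_in_multi_index: "xs \<in> tensor_basis d n N \<Longrightarrow> entry d n xs \<in> multi_index (pairs d n) N"
  by (auto simp: entry_def tensor_basis_iff pairs_def)

lemma array_in_tensor_basis: "x \<in> multi_index (pairs d n) N \<Longrightarrow> array d n x \<in> tensor_basis d n N"
  by (auto simp: array_def tensor_basis_iff pairs_def)

lemma array_entry: "xs \<in> tensor_basis d n N \<Longrightarrow> array d n (entry d n xs) = xs"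
  by (auto simp: array_def entry_def tensor_basis_iff pairs_def intro!: nth_equalityI)

lemma entry_array: "x \<in> multi_index (pairs d n) N \<Longrightarrow> entry d n (array d n x) = x"
proof
  fix p :: "nat \<times> nat" assume x: "x \<in> multi_index (pairs d n) N"
  obtain a \<alpha> where p: "p = (a, \<alpha>)" by (cases p)
  show "entry d n (array d n x) p = x p"
  proof (cases "p \<in> pairs d n")
    case True
    then have "a - 1 < n" "\<alpha> - 1 < d" "Suc (a - 1) = a" "Suc (\<alpha> - 1) = \<alpha>" by (auto simp: p pairs_def)
    then show ?thesis using True by (simp add: entry_def array_def p)
  next
    case False
    then show ?thesis unfolding PiE_arb[OF x False] by (simp add: entry_def)
  qed
qed

lemma bij_betw_entry: "bij_betw (entry d n) (tensor_basis d n N) (multi_index (pairs d n) N)"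
  by (rule bij_betw_byWitness[where f' = "array d n"])
    (use array_entry entry_array entry_in_multi_index array_in_tensor_basis in blast)+

lemma prod_pairs: "(\<Prod>p\<in>pairs d n. f p) = (\<Prod>a<n. \<Prod>\<alpha><d. f (Suc a, Suc \<alpha>))"
proof -
  have "(\<Prod>p\<in>pairs d n. f p) = (\<Prod>a\<in>{1..n}. \<Prod>\<alpha>\<in>{1..d}. f (a, \<alpha>))"
    unfolding pairs_def by (simp add: prod.cartesian_product)
  then show ?thesis by (simp add: prod.atLeast1_atMost_eq)
qed

lemma op_power_entry:
  "op_power n (op_power d K) xs ys = (\<Prod>p\<in>pairs d n. K (entry d n xs p) (entry d n ys p))"
  unfolding prod_pairs op_power_def by (intro prod.cong refl) (auto simp: entry_def pairs_def)

text \<open>The sums are reindexed along \<open>entry\<close>. Outside the basis the action returns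
  0, and so does \<open>T\<close> because it lies in the coordinate space.\<close>

lemma diag_action_fixed_iff:
  assumes "T \<in> coord_space (tensor_basis d n N \<times> tensor_basis d n N)"
  shows "(\<forall>g\<in>unitary_group N. diag_action d n N g T = T) \<longleftrightarrow>
    U_invariant (pairs d n) N (\<lambda>x y. T (array d n x, array d n y))"
proof -
  let ?B = "tensor_basis d n N" and ?P = "pairs d n" and ?F = "multi_index (pairs d n) N"
  let ?E = "entry d n"
  have "diag_action d n N g T = T \<longleftrightarrow> (\<forall>x\<in>?F. \<forall>y\<in>?F. (\<Sum>x'\<in>?F. \<Sum>y'\<in>?F.
      (\<Prod>p\<in>?P. g $$ (x p, x' p)) * (\<Prod>p\<in>?P. cnj (g $$ (y p, y' p))) * T (array d n x', array d n y')) =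
      T (array d n x, array d n y))" for g
  proof -
    define L where "L = (\<lambda>x y. \<Sum>x'\<in>?F. \<Sum>y'\<in>?F.
      (\<Prod>p\<in>?P. g $$ (x p, x' p)) * (\<Prod>p\<in>?P. cnj (g $$ (y p, y' p))) * T (array d n x', array d n y'))"
    have val: "diag_action d n N g T (xs, ys) = (if xs \<in> ?B \<and> ys \<in> ?B then L (?E xs) (?E ys) else 0)" for xs ys
    proof -
      have "L (?E xs) (?E ys) = (\<Sum>x'\<in>?B. \<Sum>y'\<in>?B. (\<Prod>p\<in>?P. g $$ (?E xs p, ?E x' p)) *
          (\<Prod>p\<in>?P. cnj (g $$ (?E ys p, ?E y' p))) * T (array d n (?E x'), array d n (?E y')))"
        unfolding L_def by (simp only: sum.reindex_bij_betw[OF bij_betw_entry, symmetric])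
      also have "\<dots> = (\<Sum>x'\<in>?B. \<Sum>y'\<in>?B. (\<Prod>p\<in>?P. g $$ (?E xs p, ?E x' p)) *
          (\<Prod>p\<in>?P. cnj (g $$ (?E ys p, ?E y' p))) * T (x', y'))"
        by (intro sum.cong refl) (simp add: array_entry)
      finally show ?thesis
        unfolding diag_action_def apply_op_def op_tensor_def
        by (simp add: op_power_entry fund_op_def conj_op_def sum.cartesian_product split_def)
    qed
    have "diag_action d n N g T = T \<longleftrightarrow> (\<forall>xs\<in>?B. \<forall>ys\<in>?B. L (?E xs) (?E ys) = T (xs, ys))"
    proof
      assume fixed: "diag_action d n N g T = T"
      then show "\<forall>xs\<in>?B. \<forall>ys\<in>?B. L (?E xs) (?E ys) = T (xs, ys)"
        using val fun_cong[OF fixed] by (metis (full_types))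
    next
      assume L: "\<forall>xs\<in>?B. \<forall>ys\<in>?B. L (?E xs) (?E ys) = T (xs, ys)"
      have "diag_action d n N g T (xs, ys) = T (xs, ys)" for xs ys
        unfolding val using L assms by (simp add: coord_space_def)
      then show "diag_action d n N g T = T" by (simp add: fun_eq_iff)
    qed
    also have "\<dots> \<longleftrightarrow> (\<forall>x\<in>?F. \<forall>y\<in>?F. L x y = T (array d n x, array d n y))"
    proof (intro iffI ballI)
      fix x y assume L: "\<forall>xs\<in>?B. \<forall>ys\<in>?B. L (?E xs) (?E ys) = T (xs, ys)" and xy: "x \<in> ?F" "y \<in> ?F"
      show "L x y = T (array d n x, array d n y)"
        using L[rule_format, OF array_in_tensor_basis[OF xy(1)] array_in_tensor_basis[OF xy(2)]]
        unfolding entry_array[OF xy(1)] entry_array[OF xy(2)] .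
    next
      fix x y assume L: "\<forall>x\<in>?F. \<forall>y\<in>?F. L x y = T (array d n x, array d n y)" and xy: "x \<in> ?B" "y \<in> ?B"
      show "L (?E x) (?E y) = T (x, y)"
        using L[rule_format, OF entry_in_multi_index[OF xy(1)] entry_in_multi_index[OF xy(2)]]
        unfolding array_entry[OF xy(1)] array_entry[OF xy(2)] .
    qed
    finally show ?thesis unfolding L_def .
  qed
  then show ?thesis unfolding U_invariant_def by (simp only:)
qed

text \<open>Permuting the n blocks moves the first component of a pair and keeps the second, which
  is the diagonal embedding.\<close>

lemma entry_permute_list:
  assumes xs: "xs \<in> tensor_basis d n N" and \<pi>: "\<pi> permutes {..<n}"
    and \<gamma>: "\<And>k. k < n \<Longrightarrow> \<gamma> (Suc k) = Suc (\<pi> k)"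
  shows "entry d n (permute_list \<pi> xs) = restrict (entry d n xs \<circ> diag_embed d \<gamma>) (pairs d n)"
proof
  fix p :: "nat \<times> nat"
  obtain a \<alpha> where p: "p = (a, \<alpha>)" by (cases p)
  show "entry d n (permute_list \<pi> xs) p = restrict (entry d n xs \<circ> diag_embed d \<gamma>) (pairs d n) p"
  proof (cases "p \<in> pairs d n")
    case True
    define k where "k = a - 1"
    have a: "k < n" "a = Suc k" "1 \<le> \<alpha>" "\<alpha> \<le> d" using True by (auto simp: p pairs_def k_def)
    have len: "length xs = n" using xs by (simp add: tensor_basis_iff)
    have "\<pi> k < n" using permutes_in_image[OF \<pi>, of k] a(1) by simp
    then show ?thesis
      using True a len permute_list_nth[of \<pi> xs k] \<pi> \<gamma>[OF a(1)]
      by (simp add: entry_def p diag_embed_def pairs_def)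
  qed (simp add: entry_def)
qed

lemma shift_permutation:
  assumes "\<pi> permutes {..<n}"
  obtains \<gamma> where "\<gamma> permutes {1..n}" "\<And>k. k < n \<Longrightarrow> \<gamma> (Suc k) = Suc (\<pi> k)"
proof
  have "bij_betw Suc {..<n} {1..n}" by (simp add: bij_betw_def image_Suc_lessThan)
  then show "map_permutation {..<n} Suc \<pi> permutes {1..n}"
    using assms by (rule map_permutation_permutes)
  show "map_permutation {..<n} Suc \<pi> (Suc k) = Suc (\<pi> k)" if "k < n" for k
    using that by (intro map_permutation_apply) auto
qed

lemma unshift_permutation:
  assumes "\<gamma> permutes {1..n}"
  obtains \<pi> where "\<pi> permutes {..<n}" "\<And>k. k < n \<Longrightarrow> \<gamma> (Suc k) = Suc (\<pi> k)"
proof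
  let ?p = "\<lambda>a. a - Suc 0"
  have b: "bij_betw ?p {1..n} {..<n}"
    by (rule bij_betw_byWitness[where f' = Suc]) auto
  then show "map_permutation {1..n} ?p \<gamma> permutes {..<n}"
    using assms by (rule map_permutation_permutes)
  show "\<gamma> (Suc k) = Suc (map_permutation {1..n} ?p \<gamma> k)" if "k < n" for k
    using that map_permutation_apply[OF bij_betw_imp_inj_on[OF b], of "Suc k" \<gamma>]
      permutes_in_image[OF assms, of "Suc k"] by simp
qed

lemma invariants_iff:
  "T \<in> invariants d n N \<longleftrightarrow>
     T \<in> coord_space (tensor_basis d n N \<times> tensor_basis d n N) \<and>
     (\<forall>\<gamma> \<delta>. \<gamma> permutes {1..n} \<longrightarrow> \<delta> permutes {1..n} \<longrightarrow>
       (\<forall>x\<in>multi_index (pairs d n) N. \<forall>y\<in>multi_index (pairs d n) N.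
         T (array d n (restrict (x \<circ> diag_embed d \<gamma>) (pairs d n)),
            array d n (restrict (y \<circ> diag_embed d \<delta>) (pairs d n))) = T (array d n x, array d n y))) \<and>
     U_invariant (pairs d n) N (\<lambda>x y. T (array d n x, array d n y))"
proof -
  let ?B = "tensor_basis d n N" and ?P = "pairs d n" and ?F = "multi_index (pairs d n) N"
  have sh: "permute_list \<pi> xs = array d n (restrict (entry d n xs \<circ> diag_embed d \<gamma>) ?P)"
    if "xs \<in> ?B" "\<pi> permutes {..<n}" "\<And>k. k < n \<Longrightarrow> \<gamma> (Suc k) = Suc (\<pi> k)" for xs \<pi> \<gamma>
  proof -
    have "permute_list \<pi> xs \<in> ?B"
      using that unfolding tensor_basis_def by (intro permute_list_in_tuples)
    then show ?thesis using array_entry entry_permute_list[OF that] by metis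
  qed
  have "(\<forall>\<pi> \<rho>. \<pi> permutes {..<n} \<longrightarrow> \<rho> permutes {..<n} \<longrightarrow>
      (\<forall>x\<in>?B. \<forall>y\<in>?B. T (permute_list \<pi> x, permute_list \<rho> y) = T (x, y))) \<longleftrightarrow>
    (\<forall>\<gamma> \<delta>. \<gamma> permutes {1..n} \<longrightarrow> \<delta> permutes {1..n} \<longrightarrow>
       (\<forall>x\<in>?F. \<forall>y\<in>?F. T (array d n (restrict (x \<circ> diag_embed d \<gamma>) ?P),
            array d n (restrict (y \<circ> diag_embed d \<delta>) ?P)) = T (array d n x, array d n y)))"
    (is "?L \<longleftrightarrow> ?R")
  proof
    assume L: ?L
    show ?R
    proof (intro allI impI ballI)
      fix \<gamma> \<delta> x y assume p: "\<gamma> permutes {1..n}" "\<delta> permutes {1..n}" and xy: "x \<in> ?F" "y \<in> ?F"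
      obtain \<pi> where 1: "\<pi> permutes {..<n}" "\<And>k. k < n \<Longrightarrow> \<gamma> (Suc k) = Suc (\<pi> k)"
        using unshift_permutation[OF p(1)] by blast
      obtain \<rho> where 2: "\<rho> permutes {..<n}" "\<And>k. k < n \<Longrightarrow> \<delta> (Suc k) = Suc (\<rho> k)"
        using unshift_permutation[OF p(2)] by blast
      note B = array_in_tensor_basis[OF xy(1)] array_in_tensor_basis[OF xy(2)]
      have "T (permute_list \<pi> (array d n x), permute_list \<rho> (array d n y)) = T (array d n x, array d n y)"
        using L 1(1) 2(1) B by blast
      then show "T (array d n (restrict (x \<circ> diag_embed d \<gamma>) ?P),
            array d n (restrict (y \<circ> diag_embed d \<delta>) ?P)) = T (array d n x, array d n y)"
        by (simp only: sh[OF B(1) 1] sh[OF B(2) 2] entry_array[OF xy(1)] entry_array[OF xy(2)])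
    qed
  next
    assume R: ?R
    show ?L
    proof (intro allI impI ballI)
      fix \<pi> \<rho> x y assume p: "\<pi> permutes {..<n}" "\<rho> permutes {..<n}" and xy: "x \<in> ?B" "y \<in> ?B"
      obtain \<gamma> where 1: "\<gamma> permutes {1..n}" "\<And>k. k < n \<Longrightarrow> \<gamma> (Suc k) = Suc (\<pi> k)"
        using shift_permutation[OF p(1)] by blast
      obtain \<delta> where 2: "\<delta> permutes {1..n}" "\<And>k. k < n \<Longrightarrow> \<delta> (Suc k) = Suc (\<rho> k)"
        using shift_permutation[OF p(2)] by blast
      have "T (array d n (restrict (entry d n x \<circ> diag_embed d \<gamma>) ?P),
          array d n (restrict (entry d n y \<circ> diag_embed d \<delta>) ?P)) = T (array d n (entry d n x), array d n (entry d n y))"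
        using R 1(1) 2(1) entry_in_multi_index[OF xy(1)] entry_in_multi_index[OF xy(2)] by blast
      then show "T (permute_list \<pi> x, permute_list \<rho> y) = T (x, y)"
        by (simp only: sh[OF xy(1) p(1) 1(2)] sh[OF xy(2) p(2) 2(2)] array_entry[OF xy(1)] array_entry[OF xy(2)])
    qed
  qed
  then show ?thesis
    unfolding invariants_def SymSym_def
    using tensor_Sym_power_iff[of "tuples d {..<N}" "tuples d {..<N}" T n] diag_action_fixed_iff[of T d n N]
    unfolding tensor_basis_def[symmetric] by (auto simp: finite_tuples)
qed

section \<open>The dimension of the space of invariants\<close>

lemma U_invariant_cong:
  assumes "\<And>x y. x \<in> multi_index P N \<Longrightarrow> y \<in> multi_index P N \<Longrightarrow> S x y = T x y"
  shows "U_invariant P N S \<longleftrightarrow> U_invariant P N T"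
  unfolding U_invariant_def using assms by (simp cong: sum.cong)

lemma exists_inj_multi_index:
  assumes "finite P" "card P \<le> N"
  obtains w where "w \<in> multi_index P N" "inj_on w P"
proof -
  obtain f where "f ` P \<subseteq> {..<N}" "inj_on f P"
    using card_le_inj[of P "{..<N}"] assms by auto
  then have "restrict f P \<in> multi_index P N" "inj_on (restrict f P) P"
    by (auto simp: inj_on_restrict_eq)
  then show ?thesis by (rule that)
qed

text \<open>Here the double cosets appear: relabelling the two arguments by \<gamma> and \<delta>
  multiplies the permutation of the tensor from both sides.\<close>

lemma permuted_diag_embed:
  assumes "\<gamma> permutes {1..n}" "\<delta> permutes {1..n}" "\<sigma> permutes pairs d n"
  shows "permuted (pairs d n) \<sigma> (restrict (x \<circ> diag_embed d \<gamma>) (pairs d n)) (restrict (y \<circ> diag_embed d \<delta>) (pairs d n))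
    \<longleftrightarrow> permuted (pairs d n) (diag_embed d \<gamma> \<circ> \<sigma> \<circ> diag_embed d (inv_into UNIV \<delta>)) x y"
proof -
  let ?P = "pairs d n" and ?D = "diag_embed d \<delta>" and ?D' = "diag_embed d (inv_into UNIV \<delta>)"
  have mem: "\<sigma> p \<in> ?P \<longleftrightarrow> p \<in> ?P" "?D p \<in> ?P \<longleftrightarrow> p \<in> ?P" "?D' p \<in> ?P \<longleftrightarrow> p \<in> ?P" for p
    using permutes_in_image assms(3) diag_embed_permutes[OF assms(2)]
      diag_embed_permutes[OF permutes_inv[OF assms(2)]] by metis+
  have "permuted ?P \<sigma> (restrict (x \<circ> diag_embed d \<gamma>) ?P) (restrict (y \<circ> ?D) ?P) \<longleftrightarrow>
      (\<forall>p\<in>?P. y (?D p) = x (diag_embed d \<gamma> (\<sigma> p)))"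
    by (simp add: permuted_def mem)
  also have "\<dots> \<longleftrightarrow> (\<forall>p\<in>?P. y p = x (diag_embed d \<gamma> (\<sigma> (?D' p))))"
    using mem(2,3) diag_embed_cancel[OF assms(2)] by metis
  finally show ?thesis by (simp add: permuted_def)
qed

text \<open>All permutations get weight 1, so that the symmetries in the two arguments merely
  permute the summands.\<close>

definition coset_tensor :: "nat \<Rightarrow> nat \<Rightarrow> nat \<Rightarrow> (nat \<times> nat \<Rightarrow> nat \<times> nat) set
    \<Rightarrow> nat list list \<times> nat list list \<Rightarrow> complex" where
  "coset_tensor d n N C = (\<lambda>(x, y). if x \<in> tensor_basis d n N \<and> y \<in> tensor_basis d n N
     then \<Sum>\<sigma>\<in>C. of_bool (permuted (pairs d n) \<sigma> (entry d n x) (entry d n y)) else 0)"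

lemma coset_tensor_array:
  assumes "x \<in> multi_index (pairs d n) N" "y \<in> multi_index (pairs d n) N"
  shows "coset_tensor d n N C (array d n x, array d n y) = (\<Sum>\<sigma>\<in>C. of_bool (permuted (pairs d n) \<sigma> x y))"
  using assms by (simp add: coset_tensor_def array_in_tensor_basis entry_array)

lemma double_coset_closed:
  assumes C: "C \<in> Sym_pairs d n // noncolor_rel d n" and s: "\<sigma> \<in> C"
    and p: "\<gamma> permutes {1..n}" "\<delta> permutes {1..n}"
  shows "diag_embed d \<gamma> \<circ> \<sigma> \<circ> diag_embed d (inv_into UNIV \<delta>) \<in> C"
proof -
  have \<sigma>: "\<sigma> permutes pairs d n"
    using C s in_quotient_imp_subset[OF equiv_noncolor_rel] by (auto simp: Sym_pairs_def)
  let ?t = "diag_embed d \<gamma> \<circ> \<sigma> \<circ> diag_embed d (inv_into UNIV \<delta>)"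
  have "?t permutes pairs d n"
    using \<sigma> p by (intro permutes_compose diag_embed_permutes permutes_inv)
  then have "(\<sigma>, ?t) \<in> noncolor_rel d n" unfolding noncolor_rel_iff using \<sigma> p by blast
  then show ?thesis using in_quotient_imp_closed[OF equiv_noncolor_rel C s] by blast
qed

lemma coset_tensor_in_invariants:
  assumes C: "C \<in> Sym_pairs d n // noncolor_rel d n"
  shows "coset_tensor d n N C \<in> invariants d n N"
  unfolding invariants_iff
proof (intro conjI allI impI ballI)
  let ?P = "pairs d n" and ?F = "multi_index (pairs d n) N"
  have perm: "\<sigma> permutes ?P" if "\<sigma> \<in> C" for \<sigma>
    using C that in_quotient_imp_subset[OF equiv_noncolor_rel] by (auto simp: Sym_pairs_def)
  show "coset_tensor d n N C \<in> coord_space (tensor_basis d n N \<times> tensor_basis d n N)"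
    by (auto simp: coord_space_def coset_tensor_def)
  have "U_invariant ?P N (\<lambda>x y. \<Sum>\<sigma>\<in>C. 1 * of_bool (permuted ?P \<sigma> x y))"
    by (intro U_invariant_sum U_invariant_permuted perm) simp
  then show "U_invariant ?P N (\<lambda>x y. coset_tensor d n N C (array d n x, array d n y))"
    by (subst U_invariant_cong) (auto simp: coset_tensor_array)
  fix \<gamma> \<delta> x y assume p: "\<gamma> permutes {1..n}" "\<delta> permutes {1..n}" and xy: "x \<in> ?F" "y \<in> ?F"
  let ?x = "restrict (x \<circ> diag_embed d \<gamma>) ?P" and ?y = "restrict (y \<circ> diag_embed d \<delta>) ?P"
  let ?i = "inv_into UNIV"
  have xy': "?x \<in> ?F" "?y \<in> ?F"
    using restrict_comp_in_multi_index[OF diag_embed_permutes] p xy by blast+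
  have "(\<Sum>\<sigma>\<in>C. of_bool (permuted ?P \<sigma> ?x ?y)) = (\<Sum>\<sigma>\<in>C. of_bool (permuted ?P \<sigma> x y) :: complex)"
  proof (rule sum.reindex_bij_witness[of _ "\<lambda>\<sigma>. diag_embed d (?i \<gamma>) \<circ> \<sigma> \<circ> diag_embed d (?i (?i \<delta>))"
        "\<lambda>\<sigma>. diag_embed d \<gamma> \<circ> \<sigma> \<circ> diag_embed d (?i \<delta>)"])
    fix \<sigma> assume s: "\<sigma> \<in> C"
    show "diag_embed d \<gamma> \<circ> \<sigma> \<circ> diag_embed d (?i \<delta>) \<in> C"
      by (rule double_coset_closed[OF C s p])
    show "diag_embed d (?i \<gamma>) \<circ> \<sigma> \<circ> diag_embed d (?i (?i \<delta>)) \<in> C"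
      by (rule double_coset_closed[OF C s permutes_inv[OF p(1)] permutes_inv[OF p(2)]])
    show "diag_embed d (?i \<gamma>) \<circ> (diag_embed d \<gamma> \<circ> \<sigma> \<circ> diag_embed d (?i \<delta>)) \<circ> diag_embed d (?i (?i \<delta>)) = \<sigma>"
      "diag_embed d \<gamma> \<circ> (diag_embed d (?i \<gamma>) \<circ> \<sigma> \<circ> diag_embed d (?i (?i \<delta>))) \<circ> diag_embed d (?i \<delta>) = \<sigma>"
      by (simp_all add: fun_eq_iff permutes_inv_inv[OF p(2)] diag_embed_cancel[OF p(1)] diag_embed_cancel[OF p(2)])
    show "of_bool (permuted ?P (diag_embed d \<gamma> \<circ> \<sigma> \<circ> diag_embed d (?i \<delta>)) x y) =
        (of_bool (permuted ?P \<sigma> ?x ?y) :: complex)"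
      by (simp only: permuted_diag_embed[OF p perm[OF s]])
  qed
  then show "coset_tensor d n N C (array d n ?x, array d n ?y) = coset_tensor d n N C (array d n x, array d n y)"
    by (simp only: coset_tensor_array[OF xy] coset_tensor_array[OF xy'])
qed

text \<open>These evaluations are dual to the coset tensors, because distinct double cosets are
  disjoint.\<close>

lemma coset_tensor_at_injective:
  assumes w: "w \<in> multi_index (pairs d n) N" "inj_on w (pairs d n)"
    and C: "C \<in> Sym_pairs d n // noncolor_rel d n" and \<sigma>: "\<sigma> permutes pairs d n"
  shows "coset_tensor d n N C (array d n w, array d n (restrict (w \<circ> \<sigma>) (pairs d n))) = of_bool (\<sigma> \<in> C)"
proof -
  let ?P = "pairs d n"
  have sub: "C \<subseteq> Sym_pairs d n" by (rule in_quotient_imp_subset[OF equiv_noncolor_rel C])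
  have fin: "finite C" by (rule finite_subset[OF sub finite_Sym_pairs])
  have "coset_tensor d n N C (array d n w, array d n (restrict (w \<circ> \<sigma>) ?P)) =
      (\<Sum>\<tau>\<in>C. of_bool (permuted ?P \<tau> w (restrict (w \<circ> \<sigma>) ?P)))"
    by (rule coset_tensor_array[OF w(1) restrict_comp_in_multi_index[OF \<sigma> w(1)]])
  also have "\<dots> = (\<Sum>\<tau>\<in>C. if \<tau> = \<sigma> then 1 else 0)"
  proof (rule sum.cong[OF refl])
    fix \<tau> assume "\<tau> \<in> C"
    then have "\<tau> permutes ?P" using sub by (auto simp: Sym_pairs_def)
    then show "of_bool (permuted ?P \<tau> w (restrict (w \<circ> \<sigma>) ?P)) = (if \<tau> = \<sigma> then 1 else 0 :: complex)"
      using permuted_inj[OF w(2) _ \<sigma>] by simp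
  qed
  also have "\<dots> = of_bool (\<sigma> \<in> C)" using fin by simp
  finally show ?thesis .
qed

text \<open>The expansion in permutation tensors has uniquely readable coefficients, so symmetry of
  the tensor makes them constant on double cosets, and the sum can be grouped by coset.\<close>

lemma invariants_subset_span:
  assumes "n * d \<le> N"
  shows "invariants d n N \<subseteq> fun_space.span (coset_tensor d n N ` (Sym_pairs d n // noncolor_rel d n))"
proof
  fix T assume "T \<in> invariants d n N"
  let ?P = "pairs d n" and ?F = "multi_index (pairs d n) N" and ?Q = "Sym_pairs d n // noncolor_rel d n"
  define S where "S = (\<lambda>x y. T (array d n x, array d n y))"
  have T: "T \<in> coord_space (tensor_basis d n N \<times> tensor_basis d n N)"
    and sym: "\<And>\<gamma> \<delta> x y. \<gamma> permutes {1..n} \<Longrightarrow> \<delta> permutes {1..n} \<Longrightarrow> x \<in> ?F \<Longrightarrow> y \<in> ?F \<Longrightarrow>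
      S (restrict (x \<circ> diag_embed d \<gamma>) ?P) (restrict (y \<circ> diag_embed d \<delta>) ?P) = S x y"
    and inv: "U_invariant ?P N S"
    using \<open>T \<in> invariants d n N\<close> unfolding invariants_iff S_def by blast+
  obtain w where w: "w \<in> ?F" "inj_on w ?P"
    by (rule exists_inj_multi_index[OF finite_pairs, of d n N]) (use assms in simp_all)
  define c where "c = (\<lambda>\<sigma>. S w (restrict (w \<circ> \<sigma>) ?P))"
  have expand: "S x y = (\<Sum>\<sigma>\<in>Sym_pairs d n. c \<sigma> * of_bool (permuted ?P \<sigma> x y))" if "x \<in> ?F" "y \<in> ?F" for x y
    unfolding c_def Sym_pairs_def
    by (rule U_invariant_expansion[where T = S, OF finite_pairs inv _ w that]) (use assms in simp)
  have c_class: "c \<tau> = c \<sigma>" if st: "(\<sigma>, \<tau>) \<in> noncolor_rel d n" for \<sigma> \<tau>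
  proof -
    obtain \<gamma> \<delta> where *: "\<sigma> permutes ?P" "\<tau> permutes ?P" "\<gamma> permutes {1..n}" "\<delta> permutes {1..n}"
      "\<tau> = diag_embed d \<gamma> \<circ> \<sigma> \<circ> diag_embed d (inv_into UNIV \<delta>)"
      using st unfolding noncolor_rel_iff by blast
    let ?y = "restrict (w \<circ> \<tau>) ?P"
    have y: "?y \<in> ?F" by (rule restrict_comp_in_multi_index[OF *(2) w(1)])
    \<comment> \<open>Symmetry moves the entry to arguments relabelled by \<gamma> and \<delta>. In
      the expansion there, a term survives only if two-sided multiplication takes its permutation to
      \<tau>, which happens for \<sigma> alone.\<close>
    have "c \<tau> = S (restrict (w \<circ> diag_embed d \<gamma>) ?P) (restrict (?y \<circ> diag_embed d \<delta>) ?P)"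
      unfolding c_def by (rule sym[OF *(3,4) w(1) y, symmetric])
    also have "\<dots> = (\<Sum>\<upsilon>\<in>Sym_pairs d n. c \<upsilon> * of_bool (permuted ?P \<upsilon> (restrict (w \<circ> diag_embed d \<gamma>) ?P)
        (restrict (?y \<circ> diag_embed d \<delta>) ?P)))"
      by (intro expand restrict_comp_in_multi_index diag_embed_permutes * w y)
    also have "\<dots> = (\<Sum>\<upsilon>\<in>Sym_pairs d n. if \<upsilon> = \<sigma> then c \<upsilon> else 0)"
    proof (rule sum.cong[OF refl])
      fix \<upsilon> assume "\<upsilon> \<in> Sym_pairs d n"
      then have u: "\<upsilon> permutes ?P" by (simp add: Sym_pairs_def)
      have perm: "diag_embed d \<gamma> \<circ> \<upsilon> \<circ> diag_embed d (inv_into UNIV \<delta>) permutes ?P"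
        using * u by (intro permutes_compose diag_embed_permutes permutes_inv)
      have "diag_embed d \<gamma> \<circ> \<upsilon> \<circ> diag_embed d (inv_into UNIV \<delta>) = \<tau> \<longleftrightarrow> \<upsilon> = \<sigma>"
        unfolding *(5) fun_eq_iff o_apply
        using diag_embed_cancel[OF *(3)] diag_embed_cancel[OF *(4)] by metis
      then show "c \<upsilon> * of_bool (permuted ?P \<upsilon> (restrict (w \<circ> diag_embed d \<gamma>) ?P)
          (restrict (?y \<circ> diag_embed d \<delta>) ?P)) = (if \<upsilon> = \<sigma> then c \<upsilon> else 0)"
        unfolding permuted_diag_embed[OF *(3,4) u] permuted_inj[OF w(2) perm *(2)] by simp
    qed
    also have "\<dots> = c \<sigma>"
    proof -
      have "\<sigma> \<in> Sym_pairs d n" using *(1) by (simp add: Sym_pairs_def)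
      then show ?thesis by simp
    qed
    finally show ?thesis .
  qed
  define r where "r = (\<lambda>C. c (SOME \<sigma>. \<sigma> \<in> C))"
  have r: "c \<sigma> = r C" if "C \<in> ?Q" "\<sigma> \<in> C" for C \<sigma>
  proof -
    have "(SOME \<tau>. \<tau> \<in> C) \<in> C" using that(2) by (rule someI[where P = "\<lambda>\<tau>. \<tau> \<in> C"])
    then have "(\<sigma>, SOME \<tau>. \<tau> \<in> C) \<in> noncolor_rel d n"
      using quotient_eq_iff[OF equiv_noncolor_rel that(1) that(1) that(2)] by blast
    then show ?thesis unfolding r_def by (rule c_class[symmetric])
  qed
  have "T = (\<Sum>C\<in>?Q. (\<lambda>z. r C * coset_tensor d n N C z))"
  proof
    fix z :: "nat list list \<times> nat list list"
    obtain x y where z: "z = (x, y)" by (cases z)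
    show "T z = (\<Sum>C\<in>?Q. (\<lambda>z. r C * coset_tensor d n N C z)) z"
    proof (cases "x \<in> tensor_basis d n N \<and> y \<in> tensor_basis d n N")
      case True
      then have F: "entry d n x \<in> ?F" "entry d n y \<in> ?F" using entry_in_multi_index by blast+
      have "T z = S (entry d n x) (entry d n y)" using True by (simp add: S_def array_entry[where N = N] z)
      also have "\<dots> = (\<Sum>C\<in>?Q. \<Sum>\<sigma>\<in>C. c \<sigma> * of_bool (permuted ?P \<sigma> (entry d n x) (entry d n y)))"
        unfolding expand[OF F] by (rule sum_quotient[OF equiv_noncolor_rel finite_Sym_pairs])
      also have "\<dots> = (\<Sum>C\<in>?Q. \<Sum>\<sigma>\<in>C. r C * of_bool (permuted ?P \<sigma> (entry d n x) (entry d n y)))"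
        by (intro sum.cong refl) (simp add: r)
      also have "\<dots> = (\<Sum>C\<in>?Q. r C * coset_tensor d n N C z)"
        using True by (simp add: coset_tensor_def z sum_distrib_left)
      finally show ?thesis by (simp add: sum_fun_apply)
    next
      case False
      then have "T z = 0" using T by (auto simp: coord_space_def z)
      moreover have "coset_tensor d n N C z = 0" for C using False by (auto simp: coset_tensor_def z)
      ultimately show ?thesis by (simp add: sum_fun_apply)
    qed
  qed
  also have "\<dots> \<in> fun_space.span (coset_tensor d n N ` ?Q)"
    by (intro fun_space.span_sum fun_space.span_scale fun_space.span_base imageI)
  finally show "T \<in> fun_space.span (coset_tensor d n N ` ?Q)" .
qed

lemma dim_invariants:
  assumes "n * d \<le> N"
  shows "fun_space.dim (invariants d n N) = Z_noncolor d n"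
proof (rule fun_space.dim_unique)
  let ?P = "pairs d n" and ?Q = "Sym_pairs d n // noncolor_rel d n" and ?t = "coset_tensor d n N"
  obtain w where w: "w \<in> multi_index ?P N" "inj_on w ?P"
    by (rule exists_inj_multi_index[OF finite_pairs, of d n N]) (use assms in simp_all)
  have finQ: "finite ?Q" by (rule finite_quotient[OF finite_Sym_pairs equiv_type[OF equiv_noncolor_rel]])
  \<comment> \<open>A point at which one coset tensor is 1 and all others are 0; it yields both
    injectivity of the family and linear independence.\<close>
  have rep: "\<exists>z. \<forall>C'\<in>?Q. ?t C' z = of_bool (C' = C)" if C: "C \<in> ?Q" for C
  proof -
    obtain \<sigma> where s: "\<sigma> \<in> C" using in_quotient_imp_non_empty[OF equiv_noncolor_rel C] by blast
    then have p: "\<sigma> permutes ?P"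
      using in_quotient_imp_subset[OF equiv_noncolor_rel C] by (auto simp: Sym_pairs_def)
    have iff: "\<sigma> \<in> C' \<longleftrightarrow> C' = C" if "C' \<in> ?Q" for C'
      using quotient_disj[OF equiv_noncolor_rel C that] s by blast
    show ?thesis
      by (rule exI[of _ "(array d n w, array d n (restrict (w \<circ> \<sigma>) ?P))"])
        (simp add: coset_tensor_at_injective[OF w _ p] iff)
  qed
  have inj: "inj_on ?t ?Q"
  proof (rule inj_onI)
    fix C C' assume CC: "C \<in> ?Q" "C' \<in> ?Q" "?t C = ?t C'"
    obtain z where "\<forall>D\<in>?Q. ?t D z = of_bool (D = C)" using rep[OF CC(1)] by blast
    then have "(of_bool (C' = C) :: complex) = of_bool (C = C)" using CC by metis
    then show "C = C'" by (simp split: if_splits)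
  qed
  show "?t ` ?Q \<subseteq> invariants d n N" using coset_tensor_in_invariants by blast
  show "invariants d n N \<subseteq> fun_space.span (?t ` ?Q)" by (rule invariants_subset_span[OF assms])
  show "card (?t ` ?Q) = Z_noncolor d n" unfolding Z_noncolor_def by (rule card_image[OF inj])
  show "fun_space.independent (?t ` ?Q)"
  proof (rule fun_space.independent_if_scalars_zero)
    show "finite (?t ` ?Q)" using finQ by simp
    fix f u assume sum0: "(\<Sum>v\<in>?t ` ?Q. (\<lambda>x. f v * v x)) = 0" and "u \<in> ?t ` ?Q"
    then obtain C where C: "C \<in> ?Q" "u = ?t C" by blast
    obtain z where z: "\<forall>D\<in>?Q. ?t D z = of_bool (D = C)" using rep[OF C(1)] by blast
    have "0 = (\<Sum>v\<in>?t ` ?Q. (\<lambda>x. f v * v x)) z" unfolding sum0 by simp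
    also have "\<dots> = (\<Sum>D\<in>?Q. f (?t D) * ?t D z)"
      unfolding sum_fun_apply by (rule sum.reindex_cong[OF inj]) simp_all
    also have "\<dots> = (\<Sum>D\<in>?Q. if D = C then f (?t D) else 0)"
      by (rule sum.cong[OF refl]) (simp add: z)
    also have "\<dots> = f u" using finQ C by simp
    finally show "f u = 0" by simp
  qed
qed

theorem mainTheorem7:
  fixes d n :: nat
  assumes "d \<ge> 2" and "n \<ge> 1"
  shows "real (Z_noncolor d n) =
           (\<Sum>p \<in> partitions_of n. \<Prod>i=1..n.
              real i ^ ((d - 2) * p i) * fact (d * p i) / (fact (p i))\<^sup>2)
         \<and> (\<exists>N\<^sub>0. \<forall>N\<ge>N\<^sub>0. fun_space.dim (invariants d n N) = Z_noncolor d n)"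
  \<comment> \<open>The threshold \<open>n * d\<close> is the number of pairs, the least N for which
    a multi-index with distinct entries exists.\<close>
  using real_Z_noncolor[OF assms(1)] by (intro conjI exI[of _ "n * d"]) (simp_all add: dim_invariants)

end
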